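(* Let $\Lambda>0$, $\boldsymbol\gamma=(\gamma_1,\gamma_2)$ with $\gamma_1,\gamma_2>0$, $(P_1,P_2)\sim\text{Vec-FDP}(\Lambda,\boldsymbol\gamma,P_0)$, and consider $d=2$ groups of observations of sizes $n_1,n_2\ge1$: conditionally on $(P_1,P_2)$, the $\theta_{j,i}$ ($j=1,2$, $1\le i\le n_j$) are independent with $\theta_{j,i}\sim P_j$. Let $K_{(n_1,n_2)}$ be the global number of clusters, i.e. the number of distinct values among all the $\theta_{j,i}$. Then, for $K\in\{1,\dots,n_1+n_2\}$, $$\mathbb P\left(K_{(n_1,n_2)}=K\right)=V(K;\boldsymbol\gamma,\Lambda)\sum_{r_1=0}^K\sum_{r_2=0}^{K-r_1}\binom{K-r_1}{r_2}\frac{(K-r_2)!}{r_1!}\prod_{j=1}^2\left|C(n_j,K-r_j;-\gamma_j)\right|,$$ where $$V(K;\boldsymbol\gamma,\Lambda)=\int_{(0,\infty)^2}\Psi(K,\boldsymbol u)\prod_{j=1}^2\frac{u_j^{n_j-1}}{\Gamma(n_j)}\frac{1}{(1+u_j)^{n_j+K\gamma_j}}\,\mathrm du_1\,\mathrm du_2,$$ $$\Psi(K,\boldsymbol u)=\Lambda^{K-1}\left(K+\Lambda\psi(\boldsymbol u)\right)e^{-\Lambda(1-\psi(\boldsymbol u))},\qquad \psi(\boldsymbol u)=\prod_{j=1}^2\frac1{(1+u_j)^{\gamma_j}},$$ and $C(n,k;-\gamma)$ denotes the central generalized factorial coefficients.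
   Context: Vec-FDP. Let $P_0$ be a diffuse (non-atomic) probability measure on $\Theta\subset\mathbb R^s$. Let $M-1\sim\text{Poisson}(\Lambda)$ (i.e. $M$ has the 1-shifted Poisson distribution $\text{Pois}_1(\Lambda)$). Conditionally on $M$, let $\tau_1,\dots,\tau_M$ be i.i.d. from $P_0$ and, independently, let $S_{j,m}\sim\text{Gamma}(\gamma_j,1)$ (shape-rate) be independent for $1\le j\le d$, $1\le m\le M$. The law of $(P_1,\dots,P_d)$ with $P_j=\sum_{m=1}^M\frac{S_{j,m}}{\sum_{r=1}^MS_{j,r}}\delta_{\tau_m}$ is denoted $\text{Vec-FDP}(\Lambda,\boldsymbol\gamma,P_0)$. Central generalized factorial coefficients. For real $\sigma$ and integers $n\ge0$, the numbers $C(n,k;\sigma)$, $0\le k\le n$, are defined by the polynomial identity in $t$: $(\sigma t)_{n\downarrow}=\sum_{k=0}^nC(n,k;\sigma)\,(t)_{k\downarrow}$, where $(x)_{n\downarrow}=x(x-1)\cdots(x-n+1)$, $(x)_{0\downarrow}=1$; and $C(n,k;\sigma)=0$ for $k>n$. Equivalently, for $\gamma>0$ and $n,k\ge1$, $|C(n,k;-\gamma)|=\frac1{k!}\sum\binom{n}{r_1,\dots,r_k}\prod_{i=1}^k\frac{\Gamma(\gamma+r_i)}{\Gamma(\gamma)}$, the sum running over positive integers $r_1,\dots,r_k$ with $r_1+\dots+r_k=n$. *)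

theory Defs
  imports "HOL-Probability.Probability"
begin

definition diffuse :: "'a measure \<Rightarrow> bool" where
  "diffuse N \<longleftrightarrow> (\<forall>x\<in>space N. emeasure N {x} = 0)"

text \<open>The Gamma law with shape \<open>a\<close> and rate 1 lives on the space of positive reals (and not on
  all reals), so that normalising by the sum below is well defined at every point of the product
  space and not just almost everywhere.\<close>

definition gamma_law :: "real \<Rightarrow> real measure" where
  "gamma_law a = density (restrict_space lborel {0<..})
     (\<lambda>x. ennreal (x powr (a - 1) * exp (- x) / Gamma a))"

definition normalized_atoms ::
    "'a measure \<Rightarrow> nat \<Rightarrow> (nat \<Rightarrow> real) \<Rightarrow> (nat \<Rightarrow> 'a) \<Rightarrow> 'a measure" where
  "normalized_atoms N M S \<tau> = measure_of (space N) (sets N)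
     (\<lambda>A. \<Sum>m=1..M. ennreal (S m / (\<Sum>r=1..M. S r)) * emeasure (return N (\<tau> m)) A)"

text \<open>The law of \<open>(P\<^sub>1, \<dots>, P\<^sub>d)\<close>, with \<open>M = k + 1\<close> for a Poisson number \<open>k\<close>. A random
  probability measure takes values in \<^const>\<open>prob_algebra\<close>, i.e. its \<open>\<sigma>\<close>-algebra is generated by
  the evaluations at measurable sets.\<close>

definition vec_fdp ::
    "nat \<Rightarrow> real \<Rightarrow> (nat \<Rightarrow> real) \<Rightarrow> 'a measure \<Rightarrow> (nat \<Rightarrow> 'a measure) measure" where
  "vec_fdp d \<Lambda> \<gamma> P0 = measure_pmf (poisson_pmf \<Lambda>) \<bind> (\<lambda>k. let M = Suc k in
     distr ((\<Pi>\<^sub>M m\<in>{1..M}. P0) \<Otimes>\<^sub>M (\<Pi>\<^sub>M (j, m)\<in>{1..d} \<times> {1..M}. gamma_law (\<gamma> j)))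
       (\<Pi>\<^sub>M j\<in>{1..d}. prob_algebra P0)
       (\<lambda>(\<tau>, S). \<lambda>j\<in>{1..d}. normalized_atoms P0 M (\<lambda>m. S (j, m)) \<tau>))"

text \<open>Conditionally on \<open>(P\<^sub>1, \<dots>, P\<^sub>d)\<close>, the \<open>\<theta>\<^sub>j\<^sub>i\<close> with \<open>1 \<le> j \<le> d\<close> and \<open>1 \<le> i \<le> n\<^sub>j\<close>
  are independent and \<open>\<theta>\<^sub>j\<^sub>i\<close> has law \<open>P\<^sub>j\<close>; the conditioning is on the \<open>\<sigma>\<close>-algebra generated
  by \<open>(P\<^sub>1, \<dots>, P\<^sub>d)\<close>.\<close>

definition cond_indep_samples ::
    "'w measure \<Rightarrow> 'a measure \<Rightarrow> nat \<Rightarrow> (nat \<Rightarrow> nat) \<Rightarrow> (nat \<Rightarrow> 'w \<Rightarrow> 'a measure) \<Rightarrow>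
     (nat \<Rightarrow> nat \<Rightarrow> 'w \<Rightarrow> 'a) \<Rightarrow> bool" where
  "cond_indep_samples \<Omega> N d n P \<theta> \<longleftrightarrow>
     (\<forall>j\<in>{1..d}. P j \<in> \<Omega> \<rightarrow>\<^sub>M prob_algebra N) \<and>
     (\<forall>j\<in>{1..d}. \<forall>i\<in>{1..n j}. \<theta> j i \<in> \<Omega> \<rightarrow>\<^sub>M N) \<and>
     (\<forall>A. (\<forall>j\<in>{1..d}. \<forall>i\<in>{1..n j}. A j i \<in> sets N) \<longrightarrow>
        (AE \<omega> in \<Omega>.
           real_cond_exp \<Omega>
             (vimage_algebra (space \<Omega>) (\<lambda>\<omega>. \<lambda>j\<in>{1..d}. P j \<omega>) (\<Pi>\<^sub>M j\<in>{1..d}. prob_algebra N))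
             (indicator {\<omega> \<in> space \<Omega>. \<forall>j\<in>{1..d}. \<forall>i\<in>{1..n j}. \<theta> j i \<omega> \<in> A j i}) \<omega>
           = (\<Prod>j=1..d. \<Prod>i=1..n j. measure (P j \<omega>) (A j i))))"

definition num_clusters ::
    "nat \<Rightarrow> (nat \<Rightarrow> nat) \<Rightarrow> (nat \<Rightarrow> nat \<Rightarrow> 'w \<Rightarrow> 'a) \<Rightarrow> 'w \<Rightarrow> nat" where
  "num_clusters d n \<theta> \<omega> = card {\<theta> j i \<omega> | j i. j \<in> {1..d} \<and> i \<in> {1..n j}}"

definition falling_fact :: "real \<Rightarrow> nat \<Rightarrow> real" where
  "falling_fact x n = (\<Prod>i<n. x - real i)"

definition gen_fact_coeff :: "nat \<Rightarrow> nat \<Rightarrow> real \<Rightarrow> real" where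
  "gen_fact_coeff n k \<sigma> =
     (THE c. (\<forall>t. falling_fact (\<sigma> * t) n = (\<Sum>k\<le>n. c k * falling_fact t k)) \<and> (\<forall>k>n. c k = 0)) k"

definition psi :: "nat \<Rightarrow> (nat \<Rightarrow> real) \<Rightarrow> (nat \<Rightarrow> real) \<Rightarrow> real" where
  "psi d \<gamma> u = (\<Prod>j=1..d. 1 / (1 + u j) powr \<gamma> j)"

definition Psi :: "nat \<Rightarrow> (nat \<Rightarrow> real) \<Rightarrow> real \<Rightarrow> nat \<Rightarrow> (nat \<Rightarrow> real) \<Rightarrow> real" where
  "Psi d \<gamma> \<Lambda> K u = \<Lambda> ^ (K - 1) * (real K + \<Lambda> * psi d \<gamma> u) * exp (- \<Lambda> * (1 - psi d \<gamma> u))"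

definition V_coeff :: "nat \<Rightarrow> (nat \<Rightarrow> nat) \<Rightarrow> nat \<Rightarrow> (nat \<Rightarrow> real) \<Rightarrow> real \<Rightarrow> real" where
  "V_coeff d n K \<gamma> \<Lambda> =
     (LINT u:({1..d} \<rightarrow>\<^sub>E {0<..})|(\<Pi>\<^sub>M j\<in>{1..d}. lborel).
        Psi d \<gamma> \<Lambda> K u *
        (\<Prod>j=1..d. u j ^ (n j - 1) / Gamma (real (n j)) *
                    (1 / (1 + u j) powr (real (n j) + real K * \<gamma> j))))"

lemma falling_fact_0 [simp]: "falling_fact x 0 = 1"
  by (simp add: falling_fact_def)

lemma falling_fact_Suc: "falling_fact x (Suc n) = falling_fact x n * (x - real n)"
  by (simp add: falling_fact_def)

lemma falling_fact_nat_eq_0: "m < k \<Longrightarrow> falling_fact (real m) k = 0"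
  by (auto simp: falling_fact_def)

lemma falling_fact_nat_neq_0: "falling_fact (real m) m \<noteq> 0"
  by (auto simp: falling_fact_def)

lemma falling_fact_expansion_unique:
  assumes "\<And>t. (\<Sum>k\<le>n. c k * falling_fact t k) = (\<Sum>k\<le>n. c' k * falling_fact t k)"
  shows "k \<le> n \<Longrightarrow> c k = c' k"
proof (induction k rule: less_induct)
  case (less k)
  have split: "(\<Sum>i\<le>n. b i * falling_fact (real k) i)
      = (\<Sum>i<k. b i * falling_fact (real k) i) + b k * falling_fact (real k) k" for b
  proof -
    have "(\<Sum>i\<le>n. b i * falling_fact (real k) i) = (\<Sum>i\<le>k. b i * falling_fact (real k) i)"
      using less.prems by (intro sum.mono_neutral_right) (auto simp: falling_fact_nat_eq_0)
    then show ?thesis by (simp add: lessThan_Suc_atMost[symmetric])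
  qed
  have "(\<Sum>i<k. c i * falling_fact (real k) i) = (\<Sum>i<k. c' i * falling_fact (real k) i)"
    using less by (intro sum.cong) auto
  then have "c k * falling_fact (real k) k = c' k * falling_fact (real k) k"
    using assms[of "real k"] by (simp add: split)
  then show ?case using falling_fact_nat_neq_0[of k] by simp
qed

lemma falling_fact_expansion_ex:
  "\<exists>c. (\<forall>t. falling_fact (\<sigma> * t) n = (\<Sum>k\<le>n. c k * falling_fact t k)) \<and> (\<forall>k>n. c k = 0)"
proof (induction n)
  case 0
  show ?case by (rule exI[of _ "\<lambda>k. if k = 0 then 1 else 0"]) auto
next
  case (Suc n)
  then obtain c where c: "\<And>t. falling_fact (\<sigma> * t) n = (\<Sum>k\<le>n. c k * falling_fact t k)"
    and c0: "\<And>k. k > n \<Longrightarrow> c k = 0" by auto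
  define c' where "c' k = (if k = 0 then 0 else \<sigma> * c (k - 1)) + (\<sigma> * real k - real n) * c k" for k
  have "falling_fact (\<sigma> * t) (Suc n) = (\<Sum>k\<le>Suc n. c' k * falling_fact t k)" for t
  proof -
    have "falling_fact (\<sigma> * t) (Suc n) = (\<Sum>k\<le>n. c k * falling_fact t k * (\<sigma> * t - real n))"
      by (simp add: falling_fact_Suc c sum_distrib_right)
    also have "\<dots> = (\<Sum>k\<le>n. \<sigma> * c k * falling_fact t (Suc k)
                        + (\<sigma> * real k - real n) * c k * falling_fact t k)"
      by (intro sum.cong) (auto simp: falling_fact_Suc algebra_simps)
    also have "\<dots> = (\<Sum>k\<le>n. \<sigma> * c k * falling_fact t (Suc k))
                  + (\<Sum>k\<le>Suc n. (\<sigma> * real k - real n) * c k * falling_fact t k)"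
      by (simp add: sum.distrib c0)
    also have "(\<Sum>k\<le>n. \<sigma> * c k * falling_fact t (Suc k))
        = (\<Sum>k\<le>Suc n. (if k = 0 then 0 else \<sigma> * c (k - 1)) * falling_fact t k)"
      by (subst sum.atMost_Suc_shift) simp
    finally show ?thesis by (simp only: c'_def distrib_right sum.distrib)
  qed
  moreover have "\<forall>k>Suc n. c' k = 0" by (auto simp: c'_def c0)
  ultimately show ?case by blast
qed

lemma gen_fact_coeff:
  shows "falling_fact (\<sigma> * t) n = (\<Sum>k\<le>n. gen_fact_coeff n k \<sigma> * falling_fact t k)"
    and "k > n \<Longrightarrow> gen_fact_coeff n k \<sigma> = 0"
proof -
  let ?Q = "\<lambda>c. (\<forall>t. falling_fact (\<sigma> * t) n = (\<Sum>k\<le>n. c k * falling_fact t k)) \<and> (\<forall>k>n. c k = 0)"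
  obtain c where c: "?Q c" using falling_fact_expansion_ex by blast
  have "c' = c" if c': "?Q c'" for c'
  proof
    fix k
    show "c' k = c k"
    proof (cases "k \<le> n")
      case True
      then show ?thesis using c c' by (intro falling_fact_expansion_unique[where n = n and c = c' and c' = c]) auto
    qed (use c c' in auto)
  qed
  then have Q: "?Q (THE c. ?Q c)" using theI[of ?Q c] c by blast
  show "falling_fact (\<sigma> * t) n = (\<Sum>k\<le>n. gen_fact_coeff n k \<sigma> * falling_fact t k)"
    using Q unfolding gen_fact_coeff_def by blast
  show "k > n \<Longrightarrow> gen_fact_coeff n k \<sigma> = 0"
    using Q unfolding gen_fact_coeff_def by blast
qed

lemma space_gamma_law [simp]: "space (gamma_law a) = {0<..}"
  by (simp add: gamma_law_def space_restrict_space)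

lemma sets_gamma_law [measurable_cong]: "sets (gamma_law a) = sets (restrict_space borel {0<..})"
  by (simp add: gamma_law_def sets_restrict_space)

lemma prob_space_gamma_law:
  assumes "a > 0"
  shows "prob_space (gamma_law a)"
proof
  have G: "Gamma a > 0" using assms by (rule Gamma_real_pos)
  have "emeasure (gamma_law a) (space (gamma_law a))
      = (\<integral>\<^sup>+x. ennreal (x powr (a - 1) * exp (- x) / Gamma a) \<partial>restrict_space lborel {0<..})"
    unfolding gamma_law_def
    by (subst emeasure_density) (auto intro!: nn_integral_cong measurable_restrict_space1
        simp: space_restrict_space sets_restrict_space)
  also have "\<dots> = (\<integral>\<^sup>+x. ennreal (x powr (a - 1) * exp (- x) / Gamma a) * indicator {0<..} x \<partial>lborel)"
    by (subst nn_integral_restrict_space) auto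
  also have "\<dots> = (\<integral>\<^sup>+x. ennreal (1 / Gamma a) *
      ennreal (indicator {0..} x * x powr (a - 1) / exp x) \<partial>lborel)"
    using AE_lborel_singleton[of "0::real"] G
    by (intro nn_integral_cong_AE, elim AE_mp)
       (auto intro!: AE_I2 simp: indicator_def exp_minus field_simps ennreal_mult[symmetric])
  also have "\<dots> = ennreal (1 / Gamma a) * ennreal (Gamma a)"
    using assms by (subst nn_integral_cmult) (auto simp: Gamma_conv_nn_integral_real)
  also have "\<dots> = 1"
    using G by (simp add: ennreal_mult[symmetric])
  finally show "emeasure (gamma_law a) (space (gamma_law a)) = 1" .
qed

lemma sets_normalized_atoms [simp]: "sets (normalized_atoms N M S \<tau>) = sets N"
  by (simp add: normalized_atoms_def)

lemma space_normalized_atoms [simp]: "space (normalized_atoms N M S \<tau>) = space N"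
  by (simp add: normalized_atoms_def)

lemma emeasure_normalized_atoms:
  assumes "A \<in> sets N"
  shows "emeasure (normalized_atoms N M S \<tau>) A =
    (\<Sum>m=1..M. ennreal (S m / (\<Sum>r=1..M. S r)) * emeasure (return N (\<tau> m)) A)"
proof (rule emeasure_measure_of[OF normalized_atoms_def])
  show "countably_additive (sets (normalized_atoms N M S \<tau>))
     (\<lambda>A. \<Sum>m=1..M. ennreal (S m / (\<Sum>r=1..M. S r)) * emeasure (return N (\<tau> m)) A)"
  proof (rule countably_additiveI)
    fix A :: "nat \<Rightarrow> 'a set"
    assume A: "range A \<subseteq> sets (normalized_atoms N M S \<tau>)" "disjoint_family A"
    then have "emeasure (return N (\<tau> m)) (\<Union>i. A i) = (\<Sum>i. emeasure (return N (\<tau> m)) (A i))" for m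
      by (intro suminf_emeasure[symmetric]) auto
    then show "(\<Sum>i. \<Sum>m=1..M. ennreal (S m / (\<Sum>r=1..M. S r)) * emeasure (return N (\<tau> m)) (A i))
        = (\<Sum>m=1..M. ennreal (S m / (\<Sum>r=1..M. S r)) * emeasure (return N (\<tau> m)) (\<Union>i. A i))"
      by (subst suminf_sum) auto
  qed
qed (use assms sets.space_closed in \<open>auto simp: positive_def\<close>)

lemma prob_space_normalized_atoms:
  assumes "M > 0" "\<And>m. m \<in> {1..M} \<Longrightarrow> S m > 0" "\<And>m. m \<in> {1..M} \<Longrightarrow> \<tau> m \<in> space N"
  shows "prob_space (normalized_atoms N M S \<tau>)"
proof
  have pos: "(\<Sum>r=1..M. S r) > 0" using assms by (intro sum_pos) auto
  have "emeasure (normalized_atoms N M S \<tau>) (space N)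
      = (\<Sum>m=1..M. ennreal (S m / (\<Sum>r=1..M. S r)))"
    using assms by (subst emeasure_normalized_atoms) auto
  also have "\<dots> = ennreal (\<Sum>m=1..M. S m / (\<Sum>r=1..M. S r))"
    using assms pos by (intro sum_ennreal) (auto intro!: divide_nonneg_pos less_imp_le)
  also have "\<dots> = 1" using pos by (simp add: sum_divide_distrib[symmetric])
  finally show "emeasure (normalized_atoms N M S \<tau>) (space (normalized_atoms N M S \<tau>)) = 1"
    by simp
qed

lemma measurable_normalized_atoms:
  assumes "M > 0"
    and S: "\<And>m. m \<in> {1..M} \<Longrightarrow> S m \<in> L \<rightarrow>\<^sub>M restrict_space borel {0<..}"
    and \<tau>: "\<And>m. m \<in> {1..M} \<Longrightarrow> \<tau> m \<in> L \<rightarrow>\<^sub>M N"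
  shows "(\<lambda>x. normalized_atoms N M (\<lambda>m. S m x) (\<lambda>m. \<tau> m x)) \<in> L \<rightarrow>\<^sub>M prob_algebra N"
proof -
  have p: "prob_space (normalized_atoms N M (\<lambda>m. S m x) (\<lambda>m. \<tau> m x))" if "x \<in> space L" for x
    using assms that measurable_space[OF S] measurable_space[OF \<tau>]
    by (intro prob_space_normalized_atoms) (auto simp: space_restrict_space)
  have [measurable]: "S m \<in> borel_measurable L" if "m \<in> {1..M}" for m
    using S[OF that] by (simp add: measurable_restrict_space2_iff)
  show ?thesis
  proof (rule measurable_prob_algebraI[OF p measurable_subprob_algebra])
    fix A assume A: "A \<in> sets N"
    have "(\<lambda>x. \<Sum>m=1..M. ennreal (S m x / (\<Sum>r=1..M. S r x)) * emeasure (return N (\<tau> m x)) A)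
        \<in> borel_measurable L"
    proof (intro borel_measurable_sum borel_measurable_times_ennreal)
      fix m assume m: "m \<in> {1..M}"
      show "(\<lambda>x. ennreal (S m x / (\<Sum>r=1..M. S r x))) \<in> borel_measurable L"
        using m by measurable
      show "(\<lambda>x. emeasure (return N (\<tau> m x)) A) \<in> borel_measurable L"
        using measurable_compose[OF measurable_compose[OF \<tau>[OF m] return_measurable]
            measurable_emeasure_subprob_algebra[OF A]] .
    qed
    then show "(\<lambda>x. emeasure (normalized_atoms N M (\<lambda>m. S m x) (\<lambda>m. \<tau> m x)) A) \<in> borel_measurable L"
      using A by (simp add: emeasure_normalized_atoms)
  qed (use p prob_space_imp_subprob_space in auto)
qed

lemma measurable_vec_fdp_map:
  assumes "M > 0"
  shows "(\<lambda>(\<tau>, S). \<lambda>j\<in>{1..d}. normalized_atoms P0 M (\<lambda>m. S (j, m)) \<tau>)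
    \<in> (\<Pi>\<^sub>M m\<in>{1..M}. P0) \<Otimes>\<^sub>M (\<Pi>\<^sub>M (j, m)\<in>{1..d} \<times> {1..M}. gamma_law (\<gamma> j))
      \<rightarrow>\<^sub>M (\<Pi>\<^sub>M j\<in>{1..d}. prob_algebra P0)"
  unfolding case_prod_beta'
proof (rule measurable_restrict)
  let ?L = "(\<Pi>\<^sub>M m\<in>{1..M}. P0) \<Otimes>\<^sub>M (\<Pi>\<^sub>M p\<in>{1..d} \<times> {1..M}. gamma_law (\<gamma> (fst p)))"
  fix j assume j: "j \<in> {1..d}"
  show "(\<lambda>x. normalized_atoms P0 M (\<lambda>m. snd x (j, m)) (fst x)) \<in> ?L \<rightarrow>\<^sub>M prob_algebra P0"
  proof (rule measurable_normalized_atoms[OF assms])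
    fix m assume m: "m \<in> {1..M}"
    have "(\<lambda>S. S (j, m)) \<in> (\<Pi>\<^sub>M p\<in>{1..d} \<times> {1..M}. gamma_law (\<gamma> (fst p))) \<rightarrow>\<^sub>M gamma_law (\<gamma> (fst (j, m)))"
      using j m by (intro measurable_component_singleton) auto
    then show "(\<lambda>x. snd x (j, m)) \<in> ?L \<rightarrow>\<^sub>M restrict_space borel {0<..}"
      using measurable_compose[OF measurable_snd]
      by (simp cong: measurable_cong_sets add: sets_gamma_law)
    show "(\<lambda>x. fst x m) \<in> ?L \<rightarrow>\<^sub>M P0"
      using m by (intro measurable_compose[OF measurable_fst measurable_component_singleton]) auto
  qed
qed

lemma vec_fdp_kernel:
  assumes "prob_space P0" "\<And>j. j \<in> {1..d} \<Longrightarrow> \<gamma> j > 0"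
  shows "(\<lambda>k. let M = Suc k in
     distr ((\<Pi>\<^sub>M m\<in>{1..M}. P0) \<Otimes>\<^sub>M (\<Pi>\<^sub>M (j, m)\<in>{1..d} \<times> {1..M}. gamma_law (\<gamma> j)))
       (\<Pi>\<^sub>M j\<in>{1..d}. prob_algebra P0)
       (\<lambda>(\<tau>, S). \<lambda>j\<in>{1..d}. normalized_atoms P0 M (\<lambda>m. S (j, m)) \<tau>))
    \<in> measure_pmf p \<rightarrow>\<^sub>M prob_algebra (\<Pi>\<^sub>M j\<in>{1..d}. prob_algebra P0)"
proof -
  have "prob_space (\<Pi>\<^sub>M (j, m)\<in>{1..d} \<times> {1..Suc k}. gamma_law (\<gamma> j))" for k
  proof -
    let ?g = "\<lambda>p. if p \<in> {1..d} \<times> {1..Suc k} then gamma_law (\<gamma> (fst p)) else gamma_law 1"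
    have "prob_space (\<Pi>\<^sub>M p\<in>{1..d} \<times> {1..Suc k}. ?g p)"
      by (rule prob_space_PiM) (auto intro!: prob_space_gamma_law assms)
    also have "(\<Pi>\<^sub>M p\<in>{1..d} \<times> {1..Suc k}. ?g p)
        = (\<Pi>\<^sub>M (j, m)\<in>{1..d} \<times> {1..Suc k}. gamma_law (\<gamma> j))"
      by (rule PiM_cong) (auto simp: case_prod_beta')
    finally show ?thesis .
  qed
  moreover have "prob_space (\<Pi>\<^sub>M m\<in>{1..Suc k}. P0)" for k
    by (rule prob_space_PiM) (rule assms)
  ultimately have "distr ((\<Pi>\<^sub>M m\<in>{1..Suc k}. P0) \<Otimes>\<^sub>M (\<Pi>\<^sub>M (j, m)\<in>{1..d} \<times> {1..Suc k}. gamma_law (\<gamma> j)))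
       (\<Pi>\<^sub>M j\<in>{1..d}. prob_algebra P0)
       (\<lambda>(\<tau>, S). \<lambda>j\<in>{1..d}. normalized_atoms P0 (Suc k) (\<lambda>m. S (j, m)) \<tau>)
    \<in> space (prob_algebra (\<Pi>\<^sub>M j\<in>{1..d}. prob_algebra P0))" for k
    unfolding space_prob_algebra mem_Collect_eq
    by (intro conjI sets_distr prob_space.prob_space_distr prob_space_pair
        measurable_vec_fdp_map zero_less_Suc)
  then show ?thesis
    unfolding Let_def measurable_pmf_measure1 by (intro Pi_I)
qed

lemma
  assumes "prob_space P0" "\<And>j. j \<in> {1..d} \<Longrightarrow> \<gamma> j > 0"
  shows sets_vec_fdp: "sets (vec_fdp d \<Lambda> \<gamma> P0) = sets (\<Pi>\<^sub>M j\<in>{1..d}. prob_algebra P0)"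
    and prob_space_vec_fdp: "prob_space (vec_fdp d \<Lambda> \<gamma> P0)"
proof -
  have p: "measure_pmf (poisson_pmf \<Lambda>) \<in> space (prob_algebra (measure_pmf (poisson_pmf \<Lambda>)))"
    by (simp add: space_prob_algebra measure_pmf.prob_space_axioms)
  note k = vec_fdp_kernel[OF assms]
  show "sets (vec_fdp d \<Lambda> \<gamma> P0) = sets (\<Pi>\<^sub>M j\<in>{1..d}. prob_algebra P0)"
    unfolding vec_fdp_def by (rule sets_bind'[OF p k])
  show "prob_space (vec_fdp d \<Lambda> \<gamma> P0)"
    unfolding vec_fdp_def by (rule prob_space_bind'[OF p k])
qed

end

theory Submission
  imports Defs
begin

text \<open>Since \<open>P0\<close> is diffuse, the atoms are almost surely distinct, so the number of clusters is the
  number of distinct labels \<open>f (j, i) \<in> {1..M}\<close>, where \<open>\<theta> j i = \<tau> (f (j, i))\<close>. Writing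
  \<open>1 / T ^ n = (\<integral>u ^ (n - 1) * exp (- u * T) / Gamma n)\<close> for the total mass \<open>T\<close> of each group decouples
  the Gamma variables: the probability of a labelling is a product of Pochhammer symbols, one for each
  group and label, times an integral over \<open>u\<close> that depends on \<open>M\<close> only. Summing the Pochhammer products
  over the labellings of a group onto a given set of \<open>k\<close> labels gives \<open>k! |C(n, k; -\<gamma>)|\<close>, and summing over
  the pairs of label sets whose union has \<open>K\<close> elements gives \<open>(M choose K) K!\<close> times the double sum.
  The remaining Poisson series in \<open>M\<close>, taken under the integral sign, is \<open>\<Psi>\<close>.\<close>

text \<open>The hypotheses concern an arbitrary \<open>\<Omega>\<close> that carries only the random
  measures and the samples. Neither \<open>M\<close> nor atoms nor labels need exist there, and the
  samples are known only through a conditional expectation. So labels are never exhibited as random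
  variables: the joint law of the tuple of samples is identified, first on rectangles, with an
  explicit mixture over a Poisson value and a labelling, and labels occur only as indices of this
  mixture. The number of clusters is a function of the tuple, so its probability can be computed in
  the mixture. Once the conditional expectation has been integrated out, all integrals take values
  in \<open>ennreal\<close>, where exchanging sums and integrals asks for measurability alone;
  \<open>enn2real\<close> is applied at the very end. In the double sum, \<open>r1\<close> and
  \<open>r2\<close> count what is missed: of the \<open>K\<close> labels that occur, group
  \<open>j\<close> misses \<open>rj\<close>. Each of these labels occurs in some group, so the
  missed sets are disjoint and \<open>r1 + r2 \<le> K\<close>.\<close>

section \<open>Counting labellings\<close>

text \<open>Polya urn: a new observation with label \<open>y\<close> multiplies the weight by
  \<open>a\<close> plus the current count at \<open>y\<close>. Summed over \<open>y\<close> this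
  gives \<open>card B * a + card J\<close> whatever the earlier labelling was, and these numbers are
  the successive factors of the rising factorial.\<close>

lemma sum_PiE_prod_pochhammer:
  fixes a :: real
  assumes "finite J" "finite B"
  shows "(\<Sum>f\<in>J \<rightarrow>\<^sub>E B. \<Prod>m\<in>B. pochhammer a (card {i\<in>J. f i = m})) = pochhammer (real (card B) * a) (card J)"
  using assms(1)
proof (induction J)
  case empty
  then show ?case by simp
next
  case (insert x J)
  let ?c = "\<lambda>f m. card {i\<in>J. f i = m}"
  let ?c' = "\<lambda>f m. card {i\<in>insert x J. f i = m}"
  have step: "(\<Sum>y\<in>B. \<Prod>m\<in>B. pochhammer a (?c' (f(x := y)) m))
      = (\<Prod>m\<in>B. pochhammer a (?c f m)) * (real (card B) * a + real (card J))" if f: "f \<in> J \<rightarrow>\<^sub>E B" for f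
  proof -
    have 1: "(\<Prod>m\<in>B. pochhammer a (?c' (f(x := y)) m)) = (\<Prod>m\<in>B. pochhammer a (?c f m)) * (a + real (?c f y))"
      if y: "y \<in> B" for y
    proof -
      have eq1: "{i\<in>insert x J. (f(x := y)) i = y} = insert x {i\<in>J. f i = y}"
        using insert.hyps by auto
      have eq2: "{i\<in>insert x J. (f(x := y)) i = m} = {i\<in>J. f i = m}" if "m \<noteq> y" for m
        using insert.hyps that by auto
      have "(\<Prod>m\<in>B. pochhammer a (?c' (f(x := y)) m))
          = pochhammer a (Suc (?c f y)) * (\<Prod>m\<in>B - {y}. pochhammer a (?c f m))"
        using y assms(2) insert.hyps eq1 eq2
        by (subst prod.remove[of _ y]) (auto intro!: prod.cong)
      also have "\<dots> = (\<Prod>m\<in>B. pochhammer a (?c f m)) * (a + real (?c f y))"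
        using y assms(2) by (subst (2) prod.remove[of _ y]) (auto simp: pochhammer_Suc)
      finally show ?thesis .
    qed
    have "(\<Sum>m\<in>B. ?c f m) = card (\<Union>m\<in>B. {i\<in>J. f i = m})"
      using insert.hyps assms(2) by (subst card_UN_disjoint) auto
    also have "(\<Union>m\<in>B. {i\<in>J. f i = m}) = J" using f by auto
    finally have 2: "(\<Sum>m\<in>B. real (?c f m)) = real (card J)"
      by (metis of_nat_sum)
    have "(\<Sum>y\<in>B. \<Prod>m\<in>B. pochhammer a (?c' (f(x := y)) m))
        = (\<Sum>y\<in>B. (\<Prod>m\<in>B. pochhammer a (?c f m)) * (a + real (?c f y)))"
      by (intro sum.cong 1 refl)
    then show ?thesis by (simp add: 2 sum_distrib_left[symmetric] sum.distrib)
  qed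
  have "(\<Sum>f\<in>insert x J \<rightarrow>\<^sub>E B. \<Prod>m\<in>B. pochhammer a (?c' f m))
      = (\<Sum>(y, f)\<in>B \<times> (J \<rightarrow>\<^sub>E B). \<Prod>m\<in>B. pochhammer a (?c' (f(x := y)) m))"
    unfolding PiE_insert_eq
    using insert.hyps inj_combinator[of x J "\<lambda>_. B"]
    by (subst sum.reindex) (auto simp: case_prod_beta')
  also have "\<dots> = (\<Sum>f\<in>J \<rightarrow>\<^sub>E B. \<Sum>y\<in>B. \<Prod>m\<in>B. pochhammer a (?c' (f(x := y)) m))"
    by (subst sum.cartesian_product[symmetric]) (rule sum.swap)
  also have "\<dots> = (\<Sum>f\<in>J \<rightarrow>\<^sub>E B. (\<Prod>m\<in>B. pochhammer a (?c f m)) * (real (card B) * a + real (card J)))"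
    by (intro sum.cong step) auto
  also have "\<dots> = pochhammer (real (card B) * a) (card (insert x J))"
    using insert by (simp add: sum_distrib_right[symmetric] pochhammer_Suc)
  finally show ?case .
qed

lemma sum_Pow_card:
  fixes h :: "nat \<Rightarrow> 'b::comm_semiring_1"
  assumes "finite B"
  shows "(\<Sum>A\<in>Pow B. h (card A)) = (\<Sum>k\<le>card B. of_nat (card B choose k) * h k)"
proof -
  have "(\<Sum>A\<in>Pow B. h (card A)) = (\<Sum>k\<le>card B. \<Sum>A\<in>{A\<in>Pow B. card A = k}. h (card A))"
    using assms by (intro sum.group[symmetric]) (auto intro: card_mono)
  also have "\<dots> = (\<Sum>k\<le>card B. of_nat (card B choose k) * h k)"
    using assms by (intro sum.cong) (auto simp: n_subsets Pow_def)
  finally show ?thesis .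
qed

lemma falling_fact_of_nat: "falling_fact (real m) k = fact k * real (m choose k)"
  by (simp add: falling_fact_def gbinomial_prod_rev binomial_gbinomial atLeast0LessThan)

lemma pochhammer_conv_falling_fact: "pochhammer x n = (-1) ^ n * falling_fact (- x) n"
  by (induction n) (auto simp: falling_fact_Suc pochhammer_Suc algebra_simps)

text \<open>The defining identity of the coefficients for \<open>- a\<close>, taken at the natural
  number \<open>m\<close> and arranged as a sum over the sizes of subsets of an
  \<open>m\<close>-element set. In this form it can be compared with the urn identity split by
  images.\<close>

lemma pochhammer_conv_gen_fact_coeff:
  "pochhammer (real m * a) n
     = (\<Sum>k\<le>m. real (m choose k) * ((-1) ^ n * fact k * gen_fact_coeff n k (- a)))"
proof -
  have "pochhammer (real m * a) n = (-1) ^ n * falling_fact (- a * real m) n"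
    by (simp add: pochhammer_conv_falling_fact mult.commute)
  also have "falling_fact (- a * real m) n
      = (\<Sum>k\<le>n. gen_fact_coeff n k (- a) * falling_fact (real m) k)"
    by (rule gen_fact_coeff)
  \<comment> \<open>Either of \<open>n\<close> and \<open>m\<close> may be the larger one. Beyond
    \<open>n\<close> the coefficients vanish and beyond \<open>m\<close> the falling factorials do,
    so both sums equal the one up to the maximum.\<close>
  also have "\<dots> = (\<Sum>k\<le>max n m. gen_fact_coeff n k (- a) * falling_fact (real m) k)"
    by (intro sum.mono_neutral_left) (auto simp: gen_fact_coeff(2))
  also have "\<dots> = (\<Sum>k\<le>m. gen_fact_coeff n k (- a) * falling_fact (real m) k)"
    by (intro sum.mono_neutral_right) (auto simp: falling_fact_nat_eq_0)
  finally show ?thesis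
    by (simp add: sum_distrib_left falling_fact_of_nat mult_ac)
qed

text \<open>Sorting the surjections by fibre sizes would give the multinomial formula for the
  absolute coefficients. The proof needs no fibre sizes: the urn identity and the polynomial
  identity hold for every finite label set, and this determines the contribution of each
  image.\<close>

lemma sum_surj_prod_pochhammer:
  assumes "finite J" "finite A" "a > 0"
  shows "(\<Sum>f\<in>{f \<in> J \<rightarrow>\<^sub>E A. f ` J = A}. \<Prod>m\<in>A. pochhammer a (card {i\<in>J. f i = m}))
    = fact (card A) * \<bar>gen_fact_coeff (card J) (card A) (- a)\<bar>"
proof -
  let ?T = "\<lambda>A. \<Sum>f\<in>{f \<in> J \<rightarrow>\<^sub>E A. f ` J = A}. \<Prod>m\<in>A. pochhammer a (card {i\<in>J. f i = m})"
  let ?h = "\<lambda>k. (-1) ^ card J * fact k * gen_fact_coeff (card J) k (- a)"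
  \<comment> \<open>Grouping all maps into \<open>A\<close> by their image shows that both sides have the same sum over \<open>Pow A\<close>.\<close>
  have T: "?T A = ?h (card A)"
    using assms(2)
  proof (induction A rule: finite_psubset_induct)
    case (psubset A)
    have "(\<Sum>A'\<in>Pow A. ?T A')
        = (\<Sum>A'\<in>Pow A. \<Sum>f\<in>{f \<in> J \<rightarrow>\<^sub>E A. f ` J = A'}. \<Prod>m\<in>A. pochhammer a (card {i\<in>J. f i = m}))"
    proof (intro sum.cong)
      fix A' f assume f: "A' \<in> Pow A" "f \<in> {f \<in> J \<rightarrow>\<^sub>E A. f ` J = A'}"
      \<comment> \<open>Labels outside the image have empty fibres and contribute the factor 1, so
        the product may run over all of \<open>A\<close>.\<close>
      have "pochhammer a (card {i\<in>J. f i = m}) = 1" if "m \<in> A - A'" for m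
      proof -
        have "{i\<in>J. f i = m} = {}" using f that by auto
        then show ?thesis by (simp only: card.empty pochhammer_0)
      qed
      with f(1) show "(\<Prod>m\<in>A'. pochhammer a (card {i\<in>J. f i = m})) = (\<Prod>m\<in>A. pochhammer a (card {i\<in>J. f i = m}))"
        using psubset.hyps by (intro prod.mono_neutral_left) auto
    next
      fix A' assume "A' \<in> Pow A"
      then show "{f \<in> J \<rightarrow>\<^sub>E A'. f ` J = A'} = {f \<in> J \<rightarrow>\<^sub>E A. f ` J = A'}"
        by (auto simp: PiE_def)
    qed auto
    also have "\<dots> = (\<Sum>f\<in>J \<rightarrow>\<^sub>E A. \<Prod>m\<in>A. pochhammer a (card {i\<in>J. f i = m}))"
      using psubset.hyps assms(1) by (intro sum.group) (auto intro: finite_PiE)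
    also have "\<dots> = (\<Sum>A'\<in>Pow A. ?h (card A'))"
      using psubset.hyps assms(1)
      by (simp add: sum_PiE_prod_pochhammer pochhammer_conv_gen_fact_coeff sum_Pow_card[where h = ?h])
    finally have "(\<Sum>A'\<in>Pow A - {A}. ?T A') + ?T A = (\<Sum>A'\<in>Pow A - {A}. ?h (card A')) + ?h (card A)"
      using psubset.hyps
        sum.remove[of "Pow A" A ?T] sum.remove[of "Pow A" A "\<lambda>A'. ?h (card A')"]
      by simp
    moreover have "(\<Sum>A'\<in>Pow A - {A}. ?T A') = (\<Sum>A'\<in>Pow A - {A}. ?h (card A'))"
      using psubset.IH by (intro sum.cong) auto
    ultimately show ?case by linarith
  qed
  \<comment> \<open>Nonnegativity of the weights absorbs the sign \<open>(-1) ^ card J\<close> into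
    the absolute value.\<close>
  have "?T A \<ge> 0"
    using assms(3) by (intro sum_nonneg prod_nonneg) (auto intro!: pochhammer_nonneg)
  then have "?T A = \<bar>?h (card A)\<bar>" using T by simp
  also have "\<dots> = fact (card A) * \<bar>gen_fact_coeff (card J) (card A) (- a)\<bar>"
    by (simp add: abs_mult power_abs)
  finally show ?thesis .
qed

text \<open>Two subsets cover \<open>U\<close> exactly when their complements in \<open>U\<close>
  are disjoint. So one chooses the complement of \<open>A1\<close> freely and that of
  \<open>A2\<close> inside the rest; \<open>r1\<close> and \<open>r2\<close> are the sizes of these
  complements.\<close>

lemma sum_pairs_Un_eq:
  fixes h :: "nat \<Rightarrow> nat \<Rightarrow> 'b::comm_semiring_1"
  assumes "finite U" "card U = K"
  shows "(\<Sum>(A1, A2)\<in>{(A1, A2). A1 \<union> A2 = U}. h (card A1) (card A2))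
     = (\<Sum>r1\<le>K. \<Sum>r2\<le>K - r1. of_nat (K choose r1) * of_nat ((K - r1) choose r2) * h (K - r1) (K - r2))"
proof -
  have "(\<Sum>(A1, A2)\<in>{(A1, A2). A1 \<union> A2 = U}. h (card A1) (card A2))
      = (\<Sum>(X, Y)\<in>(SIGMA X:Pow U. Pow (U - X)). h (K - card X) (K - card Y))"
    using assms
    by (intro sum.reindex_bij_witness[of _ "\<lambda>(X, Y). (U - X, U - Y)" "\<lambda>(X, Y). (U - X, U - Y)"])
       (auto simp: card_Diff_subset finite_subset card_mono)
  also have "\<dots> = (\<Sum>X\<in>Pow U. \<Sum>Y\<in>Pow (U - X). h (K - card X) (K - card Y))"
    using assms by (subst sum.Sigma) auto
  also have "\<dots> = (\<Sum>X\<in>Pow U. \<Sum>r2\<le>K - card X. of_nat ((K - card X) choose r2) * h (K - card X) (K - r2))"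
    using assms
    by (intro sum.cong refl, subst sum_Pow_card[where h = "\<lambda>r2. h (K - card _) (K - r2)"])
       (auto simp: card_Diff_subset finite_subset)
  also have "\<dots> = (\<Sum>r1\<le>K. \<Sum>r2\<le>K - r1. of_nat (K choose r1) * of_nat ((K - r1) choose r2) * h (K - r1) (K - r2))"
    using assms
    by (subst sum_Pow_card[where h = "\<lambda>r1. \<Sum>r2\<le>K - r1. of_nat ((K - r1) choose r2) * h (K - r1) (K - r2)"])
       (auto simp: sum_distrib_left mult.assoc)
  finally show ?thesis .
qed

lemma sum_image_eq_prod_pochhammer:
  assumes "finite J" "finite B" "A \<subseteq> B" "a > 0"
  shows "(\<Sum>f\<in>{f \<in> J \<rightarrow>\<^sub>E B. f ` J = A}. \<Prod>m\<in>B. pochhammer a (card {i\<in>J. f i = m}))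
    = fact (card A) * \<bar>gen_fact_coeff (card J) (card A) (- a)\<bar>"
proof -
  have "(\<Sum>f\<in>{f \<in> J \<rightarrow>\<^sub>E B. f ` J = A}. \<Prod>m\<in>B. pochhammer a (card {i\<in>J. f i = m}))
      = (\<Sum>f\<in>{f \<in> J \<rightarrow>\<^sub>E A. f ` J = A}. \<Prod>m\<in>A. pochhammer a (card {i\<in>J. f i = m}))"
  proof (rule sum.cong)
    fix f assume f: "f \<in> {f \<in> J \<rightarrow>\<^sub>E A. f ` J = A}"
    have "pochhammer a (card {i\<in>J. f i = m}) = 1" if "m \<in> B - A" for m
    proof -
      have "{i\<in>J. f i = m} = {}" using f that by auto
      then show ?thesis by (simp only: card.empty pochhammer_0)
    qed
    then show "(\<Prod>m\<in>B. pochhammer a (card {i\<in>J. f i = m})) = (\<Prod>m\<in>A. pochhammer a (card {i\<in>J. f i = m}))"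
      using assms by (intro prod.mono_neutral_right) auto
  qed (use assms(3) in \<open>auto simp: PiE_def\<close>)
  also have "\<dots> = fact (card A) * \<bar>gen_fact_coeff (card J) (card A) (- a)\<bar>"
    using assms finite_subset by (intro sum_surj_prod_pochhammer)
  finally show ?thesis .
qed

text \<open>The weight is a product over the groups, which are coupled only through the size of the
  union of their images. Fixing the pair of images, and grouping these pairs by their union
  \<open>U\<close>, leaves sums that depend on cardinalities alone. The factor
  \<open>real (card B choose K) * fact K\<close> stands apart because it alone depends on the number
  of atoms.\<close>

lemma sum_two_groups_prod_pochhammer:
  fixes n :: "nat \<Rightarrow> nat" and \<gamma> :: "nat \<Rightarrow> real" and B :: "nat set"
  assumes B: "finite B" and \<gamma>: "\<And>j. \<gamma> j > 0"
  defines "I \<equiv> (SIGMA j:{1..2}. {1..n j})"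
  shows "(\<Sum>f\<in>{f \<in> I \<rightarrow>\<^sub>E B. card (f ` I) = K}.
      \<Prod>j=1..2. \<Prod>m\<in>B. pochhammer (\<gamma> j) (card {i\<in>{1..n j}. f (j, i) = m}))
    = real (card B choose K) * fact K * (\<Sum>r1=0..K. \<Sum>r2=0..K - r1.
       real ((K - r1) choose r2) * (fact (K - r2) / fact r1) *
       (\<bar>gen_fact_coeff (n 1) (K - r1) (- \<gamma> 1)\<bar> * \<bar>gen_fact_coeff (n 2) (K - r2) (- \<gamma> 2)\<bar>))"
proof -
  define \<phi> where "\<phi> j g = (\<Prod>m\<in>B. pochhammer (\<gamma> j) (card {i\<in>{1..n j}. g i = m}))" for j and g :: "nat \<Rightarrow> nat"
  define F where "F j = ({1..n j} \<rightarrow>\<^sub>E B)" for j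
  define FK where "FK = {(g1, g2). g1 \<in> F 1 \<and> g2 \<in> F 2 \<and> card (g1 ` {1..n 1} \<union> g2 ` {1..n 2}) = K}"
  define AK where "AK = {(A1, A2). A1 \<subseteq> B \<and> A2 \<subseteq> B \<and> card (A1 \<union> A2) = K}"
  define q where "q j k = fact k * \<bar>gen_fact_coeff (n j) k (- \<gamma> j)\<bar>" for j k
  have finF: "finite (F j)" for j unfolding F_def using B by (intro finite_PiE) auto
  have two: "{1..2::nat} = {1, 2}" by auto
  have I: "I = Pair 1 ` {1..n 1} \<union> Pair 2 ` {1..n 2}"
    unfolding I_def two by auto
  have "(\<Sum>f\<in>{f \<in> I \<rightarrow>\<^sub>E B. card (f ` I) = K}.
      \<Prod>j=1..2. \<Prod>m\<in>B. pochhammer (\<gamma> j) (card {i\<in>{1..n j}. f (j, i) = m}))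
    = (\<Sum>(g1, g2)\<in>FK. \<phi> 1 g1 * \<phi> 2 g2)"
  \<comment> \<open>A labelling of the disjoint union of both samples is the same as a pair of
    labellings. The restrictions keep both sides extensional, so that the two maps are mutually
    inverse.\<close>
  proof (rule sum.reindex_bij_witness[where
        i = "\<lambda>(g1, g2). \<lambda>(j, i)\<in>I. if j = 1 then g1 i else g2 i" and
        j = "\<lambda>f. (\<lambda>i\<in>{1..n 1}. f (1, i), \<lambda>i\<in>{1..n 2}. f (2, i))"])
    fix f assume f: "f \<in> {f \<in> I \<rightarrow>\<^sub>E B. card (f ` I) = K}"
    then show "(case (\<lambda>i\<in>{1..n 1}. f (1, i), \<lambda>i\<in>{1..n 2}. f (2, i)) of
        (g1, g2) \<Rightarrow> \<lambda>(j, i)\<in>I. if j = 1 then g1 i else g2 i) = f"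
      by (auto simp: I fun_eq_iff PiE_def extensional_def restrict_def image_iff split: if_splits)
    have "f ` I = (\<lambda>i\<in>{1..n 1}. f (1, i)) ` {1..n 1} \<union> (\<lambda>i\<in>{1..n 2}. f (2, i)) ` {1..n 2}"
      by (simp add: I image_Un image_image)
    then show "(\<lambda>i\<in>{1..n 1}. f (1, i), \<lambda>i\<in>{1..n 2}. f (2, i)) \<in> FK"
      using f by (auto simp: FK_def F_def I)
    have "\<phi> j (\<lambda>i\<in>{1..n j}. f (j, i)) = (\<Prod>m\<in>B. pochhammer (\<gamma> j) (card {i\<in>{1..n j}. f (j, i) = m}))" for j
      unfolding \<phi>_def by (intro prod.cong refl arg_cong2[where f = pochhammer] arg_cong[where f = card]) auto
    then show "(case (\<lambda>i\<in>{1..n 1}. f (1, i), \<lambda>i\<in>{1..n 2}. f (2, i)) of (g1, g2) \<Rightarrow> \<phi> 1 g1 * \<phi> 2 g2)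
        = (\<Prod>j=1..2. \<Prod>m\<in>B. pochhammer (\<gamma> j) (card {i\<in>{1..n j}. f (j, i) = m}))"
      unfolding two by simp
  next
    fix g assume g: "g \<in> FK"
    obtain g1 g2 where g12: "g = (g1, g2)" by (cases g)
    have g1: "g1 \<in> {1..n 1} \<rightarrow>\<^sub>E B" and g2: "g2 \<in> {1..n 2} \<rightarrow>\<^sub>E B"
      and K: "card (g1 ` {1..n 1} \<union> g2 ` {1..n 2}) = K"
      using g by (auto simp: FK_def F_def g12)
    let ?f = "\<lambda>(j, i)\<in>I. if j = 1 then g1 i else g2 i"
    have "(\<lambda>i\<in>{1..n 1}. ?f (1, i)) = g1" "(\<lambda>i\<in>{1..n 2}. ?f (2, i)) = g2"
      using g1 g2 by (auto simp: I fun_eq_iff PiE_def extensional_def)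
    then show "(\<lambda>i\<in>{1..n 1}. (case g of (g1, g2) \<Rightarrow> \<lambda>(j, i)\<in>I. if j = 1 then g1 i else g2 i) (1, i),
        \<lambda>i\<in>{1..n 2}. (case g of (g1, g2) \<Rightarrow> \<lambda>(j, i)\<in>I. if j = 1 then g1 i else g2 i) (2, i)) = g"
      by (simp add: g12)
    have "?f ` I = g1 ` {1..n 1} \<union> g2 ` {1..n 2}"
      by (simp add: I image_Un image_image)
    then show "(case g of (g1, g2) \<Rightarrow> \<lambda>(j, i)\<in>I. if j = 1 then g1 i else g2 i)
        \<in> {f \<in> I \<rightarrow>\<^sub>E B. card (f ` I) = K}"
      using g1 g2 K by (auto simp: g12 I)
  qed
  also have "\<dots> = (\<Sum>(A1, A2)\<in>AK. \<Sum>(g1, g2)\<in>{(g1, g2)\<in>FK. g1 ` {1..n 1} = A1 \<and> g2 ` {1..n 2} = A2}. \<phi> 1 g1 * \<phi> 2 g2)"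
  proof -
    have "finite AK" unfolding AK_def
      by (rule finite_subset[of _ "Pow B \<times> Pow B"]) (use B in auto)
    moreover have "finite FK" unfolding FK_def
      by (rule finite_subset[of _ "F 1 \<times> F 2"]) (use finF in auto)
    ultimately have "(\<Sum>A\<in>AK. \<Sum>g\<in>{g\<in>FK. (fst g ` {1..n 1}, snd g ` {1..n 2}) = A}. \<phi> 1 (fst g) * \<phi> 2 (snd g))
        = (\<Sum>g\<in>FK. \<phi> 1 (fst g) * \<phi> 2 (snd g))"
      by (intro sum.group) (auto simp: AK_def FK_def F_def)
    then show ?thesis by (simp add: case_prod_beta' prod_eq_iff)
  qed
  also have "\<dots> = (\<Sum>(A1, A2)\<in>AK. q 1 (card A1) * q 2 (card A2))"
  proof (intro sum.cong refl, clarify)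
    fix A1 A2 assume A: "(A1, A2) \<in> AK"
    \<comment> \<open>The constraint on the union involves the images only; once these are fixed,
      \<open>g1\<close> and \<open>g2\<close> vary independently.\<close>
    have "{(g1, g2)\<in>FK. g1 ` {1..n 1} = A1 \<and> g2 ` {1..n 2} = A2}
        = {g \<in> F 1. g ` {1..n 1} = A1} \<times> {g \<in> F 2. g ` {1..n 2} = A2}"
      using A by (auto simp: FK_def AK_def)
    then have "(\<Sum>(g1, g2)\<in>{(g1, g2)\<in>FK. g1 ` {1..n 1} = A1 \<and> g2 ` {1..n 2} = A2}. \<phi> 1 g1 * \<phi> 2 g2)
        = (\<Sum>g\<in>{g \<in> F 1. g ` {1..n 1} = A1}. \<phi> 1 g) * (\<Sum>g\<in>{g \<in> F 2. g ` {1..n 2} = A2}. \<phi> 2 g)"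
      by (simp add: sum_product sum.cartesian_product)
    also have "(\<Sum>g\<in>{g \<in> F 1. g ` {1..n 1} = A1}. \<phi> 1 g) = q 1 (card A1)"
      using sum_image_eq_prod_pochhammer[of "{1..n 1}" B A1 "\<gamma> 1"] A B \<gamma>
      by (simp add: F_def \<phi>_def q_def AK_def)
    also have "(\<Sum>g\<in>{g \<in> F 2. g ` {1..n 2} = A2}. \<phi> 2 g) = q 2 (card A2)"
      using sum_image_eq_prod_pochhammer[of "{1..n 2}" B A2 "\<gamma> 2"] A B \<gamma>
      by (simp add: F_def \<phi>_def q_def AK_def)
    finally show "(\<Sum>(g1, g2)\<in>{(g1, g2)\<in>FK. g1 ` {1..n 1} = A1 \<and> g2 ` {1..n 2} = A2}. \<phi> 1 g1 * \<phi> 2 g2)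
        = q 1 (card A1) * q 2 (card A2)" .
  qed
  also have "\<dots> = (\<Sum>U\<in>{U. U \<subseteq> B \<and> card U = K}. \<Sum>(A1, A2)\<in>{(A1, A2). A1 \<union> A2 = U}. q 1 (card A1) * q 2 (card A2))"
  proof -
    have "finite AK" unfolding AK_def
      by (rule finite_subset[of _ "Pow B \<times> Pow B"]) (use B in auto)
    then have "(\<Sum>U\<in>{U. U \<subseteq> B \<and> card U = K}. \<Sum>A\<in>{A\<in>AK. fst A \<union> snd A = U}. q 1 (card (fst A)) * q 2 (card (snd A)))
        = (\<Sum>A\<in>AK. q 1 (card (fst A)) * q 2 (card (snd A)))"
      using B by (intro sum.group) (auto simp: AK_def)
    moreover have "(\<Sum>U\<in>{U. U \<subseteq> B \<and> card U = K}. \<Sum>A\<in>{A\<in>AK. fst A \<union> snd A = U}. q 1 (card (fst A)) * q 2 (card (snd A)))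
        = (\<Sum>U\<in>{U. U \<subseteq> B \<and> card U = K}. \<Sum>(A1, A2)\<in>{(A1, A2). A1 \<union> A2 = U}. q 1 (card A1) * q 2 (card A2))"
    proof (rule sum.cong[OF refl])
      fix U assume U: "U \<in> {U. U \<subseteq> B \<and> card U = K}"
      have "A \<in> AK" if "fst A \<union> snd A = U" for A
      proof -
        have "fst A \<subseteq> B" "snd A \<subseteq> B" "card (fst A \<union> snd A) = K"
          unfolding that using that U by auto
        then show ?thesis unfolding AK_def case_prod_beta' by blast
      qed
      then have "{A\<in>AK. fst A \<union> snd A = U} = {(A1, A2). A1 \<union> A2 = U}"
        unfolding case_prod_beta' by blast
      then show "(\<Sum>A\<in>{A\<in>AK. fst A \<union> snd A = U}. q 1 (card (fst A)) * q 2 (card (snd A)))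
        = (\<Sum>(A1, A2)\<in>{(A1, A2). A1 \<union> A2 = U}. q 1 (card A1) * q 2 (card A2))"
        by (simp only: case_prod_beta')
    qed
    ultimately show ?thesis by (simp only: case_prod_beta')
  qed
  also have "\<dots> = (\<Sum>U\<in>{U. U \<subseteq> B \<and> card U = K}. \<Sum>r1\<le>K. \<Sum>r2\<le>K - r1.
      real (K choose r1) * real ((K - r1) choose r2) * (q 1 (K - r1) * q 2 (K - r2)))"
    using B finite_subset
    by (intro sum.cong refl sum_pairs_Un_eq[where h = "\<lambda>k l. q 1 k * q 2 l"]) auto
  also have "\<dots> = real (card B choose K) * (\<Sum>r1\<le>K. \<Sum>r2\<le>K - r1.
      real (K choose r1) * real ((K - r1) choose r2) * (q 1 (K - r1) * q 2 (K - r2)))"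
    using B by (simp add: n_subsets)
  also have "(\<Sum>r1\<le>K. \<Sum>r2\<le>K - r1.
      real (K choose r1) * real ((K - r1) choose r2) * (q 1 (K - r1) * q 2 (K - r2)))
    = fact K * (\<Sum>r1=0..K. \<Sum>r2=0..K - r1.
       real ((K - r1) choose r2) * (fact (K - r2) / fact r1) *
       (\<bar>gen_fact_coeff (n 1) (K - r1) (- \<gamma> 1)\<bar> * \<bar>gen_fact_coeff (n 2) (K - r2) (- \<gamma> 2)\<bar>))"
    unfolding sum_distrib_left atMost_atLeast0
  proof (intro sum.cong refl)
    fix r1 r2 assume "r1 \<in> {0..K}"
    \<comment> \<open>This cancels the factorial in \<open>q 1\<close> while that in
      \<open>q 2\<close> survives, which is why the formula does not look symmetric in the two
      groups.\<close>
    then have "real (K choose r1) * fact (K - r1) = fact K / fact r1"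
      by (simp add: binomial_fact)
    then show "real (K choose r1) * real ((K - r1) choose r2) * (q 1 (K - r1) * q 2 (K - r2))
      = fact K * (real ((K - r1) choose r2) * (fact (K - r2) / fact r1) *
       (\<bar>gen_fact_coeff (n 1) (K - r1) (- \<gamma> 1)\<bar> * \<bar>gen_fact_coeff (n 2) (K - r2) (- \<gamma> 2)\<bar>))"
      unfolding q_def by (simp add: field_simps)
  qed
  finally show ?thesis by (simp add: mult.assoc)
qed

section \<open>Gamma integrals\<close>

lemma nn_integral_gamma_scaled:
  fixes a b :: real
  assumes "a > 0" "b > 0"
  shows "(\<integral>\<^sup>+x. ennreal (x powr (a - 1) * exp (- b * x)) * indicator {0<..} x \<partial>lborel)
    = ennreal (Gamma a / b powr a)"
proof -
  let ?g = "\<lambda>x::real. ennreal (indicator {0..} x * x powr (a - 1) / exp x)"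
  have "(\<integral>\<^sup>+x. ?g x \<partial>lborel) = ennreal \<bar>b\<bar> * (\<integral>\<^sup>+x. ?g (0 + b * x) \<partial>lborel)"
    using assms by (intro nn_integral_real_affine) auto
  also have "(\<integral>\<^sup>+x. ?g (0 + b * x) \<partial>lborel)
      = (\<integral>\<^sup>+x. ennreal (b powr (a - 1)) * (ennreal (x powr (a - 1) * exp (- b * x)) * indicator {0<..} x) \<partial>lborel)"
    using AE_lborel_singleton[of "0::real"] assms
    by (intro nn_integral_cong_AE, elim AE_mp)
       (auto intro!: AE_I2 simp: indicator_def exp_minus field_simps ennreal_mult[symmetric] powr_mult
         zero_le_mult_iff)
  also have "\<dots> = ennreal (b powr (a - 1)) * (\<integral>\<^sup>+x. ennreal (x powr (a - 1) * exp (- b * x)) * indicator {0<..} x \<partial>lborel)"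
    by (intro nn_integral_cmult) auto
  finally have *: "ennreal (Gamma a) = ennreal (b powr a) * (\<integral>\<^sup>+x. ennreal (x powr (a - 1) * exp (- b * x)) * indicator {0<..} x \<partial>lborel)"
    using assms by (simp add: Gamma_conv_nn_integral_real mult.assoc[symmetric] ennreal_mult[symmetric] powr_mult_base)
  \<comment> \<open>Dividing by \<open>b powr a\<close> in \<open>ennreal\<close> is done by
    multiplying with its reciprocal, a finite constant.\<close>
  have "ennreal (1 / b powr a) * ennreal (b powr a) = 1"
    using assms by (simp add: ennreal_mult[symmetric])
  then have "(\<integral>\<^sup>+x. ennreal (x powr (a - 1) * exp (- b * x)) * indicator {0<..} x \<partial>lborel)
      = ennreal (1 / b powr a) * ennreal (Gamma a)"
    unfolding * mult.assoc[symmetric] by simp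
  also have "\<dots> = ennreal (Gamma a / b powr a)"
    using assms by (simp add: ennreal_mult[symmetric] Gamma_real_pos less_imp_le)
  finally show ?thesis .
qed

lemma nn_integral_gamma_law:
  assumes [measurable]: "f \<in> borel_measurable borel"
  shows "(\<integral>\<^sup>+x. f x \<partial>gamma_law a)
    = (\<integral>\<^sup>+x. ennreal (x powr (a - 1) * exp (- x) / Gamma a) * f x * indicator {0<..} x \<partial>lborel)"
  unfolding gamma_law_def
  by (subst nn_integral_density)
     (auto intro!: measurable_restrict_space1 simp: nn_integral_restrict_space mult_ac)

text \<open>Exponential tilting: multiplied by \<open>s ^ c * exp (- u * s)\<close>, the density is
  an unnormalised Gamma density of shape \<open>a + c\<close> and rate \<open>1 + u\<close>. The
  Pochhammer symbol is the quotient \<open>Gamma (a + c) / Gamma a\<close>.\<close>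

lemma nn_integral_gamma_law_power_exp:
  assumes "a > 0" "u \<ge> 0"
  shows "(\<integral>\<^sup>+s. ennreal (s ^ c * exp (- u * s)) \<partial>gamma_law a)
    = ennreal (pochhammer a c / (1 + u) powr (a + real c))"
proof -
  have G: "Gamma a > 0" using assms by (intro Gamma_real_pos)
  have nz: "a \<notin> \<int>\<^sub>\<le>\<^sub>0" using assms by (auto elim!: nonpos_Ints_cases)
  have eq: "s powr (a - 1) * exp (- s) * (s ^ c * exp (- u * s))
      = s powr ((a + real c) - 1) * exp (- (1 + u) * s)" if "s > 0" for s
  proof -
    have "s powr (a - 1) * s ^ c = s powr ((a + real c) - 1)"
      using that by (simp add: powr_realpow[symmetric] powr_add[symmetric] algebra_simps)
    moreover have "exp (- s) * exp (- u * s) = exp (- (1 + u) * s)"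
      by (simp add: exp_add[symmetric] algebra_simps)
    ultimately show ?thesis by (metis mult.assoc mult.left_commute)
  qed
  have "(\<integral>\<^sup>+s. ennreal (s ^ c * exp (- u * s)) \<partial>gamma_law a)
      = (\<integral>\<^sup>+s. ennreal (1 / Gamma a) *
          (ennreal (s powr ((a + real c) - 1) * exp (- (1 + u) * s)) * indicator {0<..} s) \<partial>lborel)"
  proof (subst nn_integral_gamma_law, measurable, intro nn_integral_cong)
    fix s :: real
    show "ennreal (s powr (a - 1) * exp (- s) / Gamma a) * ennreal (s ^ c * exp (- u * s)) * indicator {0<..} s
        = ennreal (1 / Gamma a) *
          (ennreal (s powr ((a + real c) - 1) * exp (- (1 + u) * s)) * indicator {0<..} s)"
      using G eq[of s] by (auto simp: indicator_def ennreal_mult[symmetric] simp del: mult_minus_left)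
  qed
  also have "\<dots> = ennreal (1 / Gamma a) * ennreal (Gamma (a + real c) / (1 + u) powr (a + real c))"
    using assms by (subst nn_integral_cmult, simp, subst nn_integral_gamma_scaled) auto
  also have "\<dots> = ennreal (pochhammer a c / (1 + u) powr (a + real c))"
    using assms G nz by (simp add: ennreal_mult[symmetric] pochhammer_Gamma Gamma_real_pos less_imp_le)
  finally show ?thesis .
qed

lemma inverse_power_conv_nn_integral:
  fixes T :: real
  assumes "T > 0" "n \<ge> 1"
  shows "ennreal (1 / T ^ n)
    = (\<integral>\<^sup>+u. ennreal (u ^ (n - 1) / Gamma (real n) * exp (- T * u)) * indicator {0<..} u \<partial>lborel)"
proof -
  have G: "Gamma (real n) > 0" using assms by (intro Gamma_real_pos) auto
  have "(\<integral>\<^sup>+u. ennreal (u ^ (n - 1) / Gamma (real n) * exp (- T * u)) * indicator {0<..} u \<partial>lborel)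
      = (\<integral>\<^sup>+u. ennreal (1 / Gamma (real n)) *
         (ennreal (u powr (real n - 1) * exp (- T * u)) * indicator {0<..} u) \<partial>lborel)"
    using G assms
    by (intro nn_integral_cong)
       (auto simp: indicator_def ennreal_mult[symmetric] powr_realpow[symmetric] of_nat_diff)
  also have "\<dots> = ennreal (1 / Gamma (real n)) * ennreal (Gamma (real n) / T powr real n)"
    using assms by (subst nn_integral_cmult, simp, subst nn_integral_gamma_scaled) auto
  also have "\<dots> = ennreal (1 / T ^ n)"
  proof -
    have "ennreal (1 / g) * ennreal (g / T powr real n) = ennreal (1 / T ^ n)" if "g > 0" for g
      using assms that by (simp add: ennreal_mult[symmetric] powr_realpow)
    then show ?thesis using G .
  qed
  finally show ?thesis by simp
qed

section \<open>The probability of a labelling\<close>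

abbreviation sample_index :: "nat \<Rightarrow> (nat \<Rightarrow> nat) \<Rightarrow> (nat \<times> nat) set" where
  "sample_index d n \<equiv> (SIGMA j:{1..d}. {1..n j})"

text \<open>Given \<open>M\<close>, the atom locations are independent of the weights, so the
  average is over the Gamma variables only.\<close>

definition label_prob :: "nat \<Rightarrow> (nat \<Rightarrow> real) \<Rightarrow> (nat \<Rightarrow> nat) \<Rightarrow> nat \<Rightarrow> (nat \<times> nat \<Rightarrow> nat) \<Rightarrow> ennreal" where
  "label_prob d \<gamma> n M f =
     (\<integral>\<^sup>+S. (\<Prod>(j, i)\<in>sample_index d n. ennreal (S (j, f (j, i)) / (\<Sum>r=1..M. S (j, r))))
       \<partial>(\<Pi>\<^sub>M (j, m)\<in>{1..d} \<times> {1..M}. gamma_law (\<gamma> j)))"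

lemma borel_measurable_gamma_law:
  "f \<in> borel_measurable borel \<Longrightarrow> f \<in> borel_measurable (gamma_law a)"
  by (subst measurable_cong_sets[OF sets_gamma_law refl]) (rule measurable_restrict_space1)

lemma measurable_gamma_law_component:
  assumes "j \<in> {1..d}" "m \<in> {1..M}"
  shows "(\<lambda>S. S (j, m)) \<in> borel_measurable (\<Pi>\<^sub>M (j, m)\<in>{1..d} \<times> {1..M::nat}. gamma_law (\<gamma> j))"
proof -
  have "(\<lambda>S. S (j, m)) \<in> (\<Pi>\<^sub>M (j, m)\<in>{1..d} \<times> {1..M}. gamma_law (\<gamma> j)) \<rightarrow>\<^sub>M (case (j, m) of (j, m) \<Rightarrow> gamma_law (\<gamma> j))"
    using assms by (intro measurable_component_singleton) auto
  moreover have "(\<lambda>x. x) \<in> borel_measurable (gamma_law (\<gamma> j))"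
    by (rule borel_measurable_gamma_law) simp
  ultimately show ?thesis
    using measurable_compose[of "\<lambda>S. S (j, m)"] by simp
qed

lemma gamma_law_component_pos:
  assumes "S \<in> space (\<Pi>\<^sub>M (j, m)\<in>{1..d} \<times> {1..M::nat}. gamma_law (\<gamma> j))" "j \<in> {1..d}" "m \<in> {1..M}"
  shows "S (j, m) > 0"
  using assms by (force simp: space_PiM PiE_def Pi_def)

text \<open>The labelling enters only through the Pochhammer symbols: the counts in group
  \<open>j\<close> add up to \<open>n j\<close>, so the powers of \<open>1 + u j\<close> from the
  single Gamma integrals combine to the exponent \<open>n j + M * \<gamma> j\<close> for every
  \<open>f\<close>.\<close>

lemma label_prob_eq:
  assumes \<gamma>: "\<And>j. \<gamma> j > 0" and n: "\<And>j. j \<in> {1..d} \<Longrightarrow> n j \<ge> 1" and M: "M \<ge> 1"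
    and f: "f \<in> sample_index d n \<rightarrow> {1..M}"
  shows "label_prob d \<gamma> n M f =
    ennreal (\<Prod>j=1..d. \<Prod>m=1..M. pochhammer (\<gamma> j) (card {i\<in>{1..n j}. f (j, i) = m})) *
    (\<integral>\<^sup>+u\<in>{1..d} \<rightarrow>\<^sub>E {0<..}. ennreal (\<Prod>j=1..d. u j ^ (n j - 1) / Gamma (real (n j)) *
        (1 / (1 + u j) powr (real (n j) + real M * \<gamma> j))) \<partial>(\<Pi>\<^sub>M j\<in>{1..d}. lborel))"
proof -
  define c where "c j m = card {i\<in>{1..n j}. f (j, i) = m}" for j m
  define g where "g j u = ennreal (u ^ (n j - 1) / Gamma (real (n j))) * indicator {0<..} u" for j and u :: real
  define h where "h j m u s = ennreal (s ^ c j m * exp (- u * s))" for j m and u s :: real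
  define G where "G = (\<Pi>\<^sub>M (j, m)\<in>{1..d} \<times> {1..M}. gamma_law (\<gamma> j))"
  have [measurable]: "{1..d} \<rightarrow>\<^sub>E {0<..} \<in> sets (\<Pi>\<^sub>M j\<in>{1..d}. lborel :: real measure)"
    by (intro sets_PiM_I_finite) auto
  have meas: "(\<lambda>u. ennreal (\<Prod>j=1..d. u j ^ (n j - 1) / Gamma (real (n j)) *
        (1 / (1 + u j) powr (real (n j) + real M * \<gamma> j))) * indicator ({1..d} \<rightarrow>\<^sub>E {0<..}) u)
      \<in> borel_measurable (\<Pi>\<^sub>M j\<in>{1..d}. lborel)"
    by measurable
  have Gm[measurable]: "(\<lambda>S. S (j, m)) \<in> borel_measurable G" if "j \<in> {1..d}" "m \<in> {1..M}" for j m
    unfolding G_def using that by (rule measurable_gamma_law_component)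
  have [measurable]: "g j \<in> borel_measurable borel" for j
    unfolding g_def by measurable
  have csum: "(\<Sum>m=1..M. c j m) = n j" if j: "j \<in> {1..d}" for j
  proof -
    have "(\<Sum>m=1..M. c j m) = card (\<Union>m\<in>{1..M}. {i\<in>{1..n j}. f (j, i) = m})"
      unfolding c_def by (subst card_UN_disjoint) auto
    also have "(\<Union>m\<in>{1..M}. {i\<in>{1..n j}. f (j, i) = m}) = {1..n j}" using f j by auto
    finally show ?thesis by simp
  qed
  interpret L: product_sigma_finite "\<lambda>j::nat. lborel :: real measure"
    by (rule product_sigma_finite.intro) (rule sigma_finite_lborel)
  have ps: "prob_space (case p of (j, m) \<Rightarrow> gamma_law (\<gamma> j))" for p :: "nat \<times> nat"
    by (cases p) (simp add: prob_space_gamma_law \<gamma>)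
  interpret gl: product_sigma_finite "\<lambda>(j, m::nat). gamma_law (\<gamma> j)"
    by (rule product_sigma_finite.intro) (rule prob_space_imp_sigma_finite[OF ps])
  interpret Ps: prob_space G unfolding G_def
    by (rule prob_space_PiM) (rule ps)
  interpret Ls: sigma_finite_measure "\<Pi>\<^sub>M j\<in>{1..d}. lborel :: real measure"
    by (rule L.sigma_finite) simp
  interpret PP: pair_sigma_finite G "\<Pi>\<^sub>M j\<in>{1..d}. lborel :: real measure" ..
  \<comment> \<open>One auxiliary variable for each group; the product of the one-dimensional
    integrals is a single integral over the product measure.\<close>
  have 1: "(\<Prod>(j, i)\<in>sample_index d n. ennreal (S (j, f (j, i)) / (\<Sum>r=1..M. S (j, r))))
      = (\<integral>\<^sup>+u. (\<Prod>j=1..d. g j (u j) * (\<Prod>m=1..M. h j m (u j) (S (j, m)))) \<partial>(\<Pi>\<^sub>M j\<in>{1..d}. lborel))"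
    if S: "S \<in> space G" for S
  proof -
    have pos: "S (j, m) > 0" if "j \<in> {1..d}" "m \<in> {1..M}" for j m
      using S that unfolding G_def by (rule gamma_law_component_pos)
    have "(\<Prod>i=1..n j. ennreal (S (j, f (j, i)) / (\<Sum>r=1..M. S (j, r))))
        = (\<integral>\<^sup>+u. g j u * (\<Prod>m=1..M. h j m u (S (j, m))) \<partial>lborel)" if j: "j \<in> {1..d}" for j
    proof -
      let ?T = "\<Sum>r=1..M. S (j, r)"
      have T: "?T > 0" using j M pos by (intro sum_pos) auto
      have "(\<Prod>i=1..n j. ennreal (S (j, f (j, i)) / ?T)) = ennreal (\<Prod>i=1..n j. S (j, f (j, i)) / ?T)"
        using f j T by (intro prod_ennreal divide_nonneg_pos less_imp_le[OF pos]) auto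
      also have "(\<Prod>i=1..n j. S (j, f (j, i)) / ?T) = (\<Prod>i=1..n j. S (j, f (j, i))) * (1 / ?T ^ n j)"
        by (simp add: prod_dividef)
      \<comment> \<open>Observations are sorted by label; label \<open>m\<close> occurs
        \<open>c j m\<close> times in group \<open>j\<close>.\<close>
      also have "(\<Prod>i=1..n j. S (j, f (j, i))) = (\<Prod>m=1..M. \<Prod>i\<in>{i\<in>{1..n j}. f (j, i) = m}. S (j, f (j, i)))"
        using f j by (intro prod.group[symmetric]) auto
      also have "\<dots> = (\<Prod>m=1..M. S (j, m) ^ c j m)"
        by (intro prod.cong refl) (simp add: c_def)
      also have "ennreal ((\<Prod>m=1..M. S (j, m) ^ c j m) * (1 / ?T ^ n j))
          = ennreal (\<Prod>m=1..M. S (j, m) ^ c j m) * ennreal (1 / ?T ^ n j)"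
        using j T by (intro ennreal_mult prod_nonneg) (auto intro!: zero_le_power less_imp_le[OF pos])
      also have "\<dots> = (\<integral>\<^sup>+u. ennreal (\<Prod>m=1..M. S (j, m) ^ c j m) *
          (ennreal (u ^ (n j - 1) / Gamma (real (n j)) * exp (- ?T * u)) * indicator {0<..} u) \<partial>lborel)"
        using T n[OF j] by (subst nn_integral_cmult) (auto simp: inverse_power_conv_nn_integral)
      also have "\<dots> = (\<integral>\<^sup>+u. g j u * (\<Prod>m=1..M. h j m u (S (j, m))) \<partial>lborel)"
      proof (intro nn_integral_cong)
        fix u :: real
        have p0: "(\<Prod>m=1..M. S (j, m) ^ c j m) \<ge> 0"
          using j by (intro prod_nonneg) (auto intro!: zero_le_power less_imp_le[OF pos])
        have "exp (- ?T * u) = (\<Prod>m=1..M. exp (- u * S (j, m)))"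
          by (simp add: exp_sum[symmetric] sum_negf sum_distrib_left mult.commute)
        moreover have "(\<Prod>m=1..M. h j m u (S (j, m))) = ennreal (\<Prod>m=1..M. S (j, m) ^ c j m * exp (- u * S (j, m)))"
          unfolding h_def using j by (intro prod_ennreal) (auto intro!: mult_nonneg_nonneg zero_le_power less_imp_le[OF pos])
        ultimately have "(\<Prod>m=1..M. h j m u (S (j, m))) = ennreal ((\<Prod>m=1..M. S (j, m) ^ c j m) * exp (- ?T * u))"
          by (simp add: prod.distrib)
        then show "ennreal (\<Prod>m=1..M. S (j, m) ^ c j m) *
          (ennreal (u ^ (n j - 1) / Gamma (real (n j)) * exp (- ?T * u)) * indicator {0<..} u)
          = g j u * (\<Prod>m=1..M. h j m u (S (j, m)))"
          using p0 Gamma_real_pos[of "real (n j)"] n[OF j]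
          by (simp add: g_def indicator_def ennreal_mult[symmetric] mult_ac)
      qed
      finally show ?thesis .
    qed
    then have "(\<Prod>(j, i)\<in>sample_index d n. ennreal (S (j, f (j, i)) / (\<Sum>r=1..M. S (j, r))))
        = (\<Prod>j=1..d. \<integral>\<^sup>+u. g j u * (\<Prod>m=1..M. h j m u (S (j, m))) \<partial>lborel)"
      by (subst prod.Sigma[symmetric]) auto
    also have "\<dots> = (\<integral>\<^sup>+u. (\<Prod>j=1..d. g j (u j) * (\<Prod>m=1..M. h j m (u j) (S (j, m)))) \<partial>(\<Pi>\<^sub>M j\<in>{1..d}. lborel))"
      by (intro L.product_nn_integral_prod[symmetric]) (auto simp: h_def)
    finally show ?thesis .
  qed
  have 2: "(\<integral>\<^sup>+S. (\<Prod>j=1..d. g j (u j) * (\<Prod>m=1..M. h j m (u j) (S (j, m)))) \<partial>G)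
      = ennreal (\<Prod>j=1..d. \<Prod>m=1..M. pochhammer (\<gamma> j) (c j m)) *
        (ennreal (\<Prod>j=1..d. u j ^ (n j - 1) / Gamma (real (n j)) *
        (1 / (1 + u j) powr (real (n j) + real M * \<gamma> j))) * indicator ({1..d} \<rightarrow>\<^sub>E {0<..}) u)"
    if u: "u \<in> space (\<Pi>\<^sub>M j\<in>{1..d}. lborel :: real measure)" for u
  proof (cases "u \<in> {1..d} \<rightarrow>\<^sub>E {0<..}")
    case False
    \<comment> \<open>Outside the open orthant some factor \<open>g j\<close> vanishes, so
      integrating over the whole product space is integrating over the orthant.\<close>
    then obtain j where "j \<in> {1..d}" "\<not> u j > 0" using u by (auto simp: space_PiM PiE_def Pi_def)
    then have z: "(\<Prod>j=1..d. g j (u j) * (\<Prod>m=1..M. h j m (u j) (S (j, m)))) = 0" for S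
      by (intro prod_zero bexI[of _ j]) (auto simp: g_def)
    show ?thesis unfolding z using False by simp
  next
    case True
    then have up: "u j > 0" if "j \<in> {1..d}" for j using that by auto
    have "(\<integral>\<^sup>+S. (\<Prod>j=1..d. g j (u j) * (\<Prod>m=1..M. h j m (u j) (S (j, m)))) \<partial>G)
        = (\<integral>\<^sup>+S. (\<Prod>j=1..d. g j (u j)) * (\<Prod>p\<in>{1..d} \<times> {1..M}. h (fst p) (snd p) (u (fst p)) (S p)) \<partial>G)"
      by (simp add: prod.distrib prod.cartesian_product case_prod_beta')
    also have "\<dots> = (\<Prod>j=1..d. g j (u j)) * (\<integral>\<^sup>+S. (\<Prod>p\<in>{1..d} \<times> {1..M}. h (fst p) (snd p) (u (fst p)) (S p)) \<partial>G)"
    proof (intro nn_integral_cmult borel_measurable_prod_ennreal)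
      fix p assume "p \<in> {1..d} \<times> {1..M}"
      then have [measurable]: "(\<lambda>S. S p) \<in> borel_measurable G" using Gm[of "fst p" "snd p"] by auto
      show "(\<lambda>S. h (fst p) (snd p) (u (fst p)) (S p)) \<in> borel_measurable G"
        unfolding h_def by measurable
    qed
    also have "(\<integral>\<^sup>+S. (\<Prod>p\<in>{1..d} \<times> {1..M}. h (fst p) (snd p) (u (fst p)) (S p)) \<partial>G)
        = (\<Prod>p\<in>{1..d} \<times> {1..M}. \<integral>\<^sup>+s. h (fst p) (snd p) (u (fst p)) s \<partial>(case p of (j, m) \<Rightarrow> gamma_law (\<gamma> j)))"
      unfolding G_def
      by (intro gl.product_nn_integral_prod)
         (auto simp: h_def case_prod_beta' intro!: borel_measurable_gamma_law)
    also have "\<dots> = (\<Prod>p\<in>{1..d} \<times> {1..M}. ennreal (pochhammer (\<gamma> (fst p)) (c (fst p) (snd p))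
          / (1 + u (fst p)) powr (\<gamma> (fst p) + real (c (fst p) (snd p)))))"
      unfolding h_def case_prod_beta'
      by (intro prod.cong refl nn_integral_gamma_law_power_exp \<gamma> less_imp_le[OF up]) auto
    also have "\<dots> = (\<Prod>j=1..d. \<Prod>m=1..M. ennreal (pochhammer (\<gamma> j) (c j m) / (1 + u j) powr (\<gamma> j + real (c j m))))"
      by (simp add: prod.cartesian_product case_prod_beta')
    also have "\<dots> = (\<Prod>j=1..d. ennreal ((\<Prod>m=1..M. pochhammer (\<gamma> j) (c j m)) * (1 / (1 + u j) powr (real (n j) + real M * \<gamma> j))))"
    proof (intro prod.cong refl)
      fix j assume j: "j \<in> {1..d}"
      have "(\<Prod>m=1..M. (1 + u j) powr (\<gamma> j + real (c j m))) = (1 + u j) powr (\<Sum>m=1..M. \<gamma> j + real (c j m))"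
        using up[OF j] by (subst powr_sum) auto
      also have "(\<Sum>m=1..M. \<gamma> j + real (c j m)) = real (n j) + real M * \<gamma> j"
        using csum[OF j] by (simp add: sum.distrib of_nat_sum[symmetric] del: of_nat_sum)
      finally show "(\<Prod>m=1..M. ennreal (pochhammer (\<gamma> j) (c j m) / (1 + u j) powr (\<gamma> j + real (c j m))))
        = ennreal ((\<Prod>m=1..M. pochhammer (\<gamma> j) (c j m)) * (1 / (1 + u j) powr (real (n j) + real M * \<gamma> j)))"
        by (subst prod_ennreal) (auto intro!: divide_nonneg_nonneg pochhammer_nonneg \<gamma> simp: prod_dividef)
    qed
    also have "(\<Prod>j=1..d. g j (u j)) * \<dots>
      = (\<Prod>j=1..d. ennreal (\<Prod>m=1..M. pochhammer (\<gamma> j) (c j m)) * ennreal (u j ^ (n j - 1) / Gamma (real (n j)) *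
        (1 / (1 + u j) powr (real (n j) + real M * \<gamma> j))))"
      unfolding prod.distrib[symmetric]
    proof (intro prod.cong refl)
      fix j assume j: "j \<in> {1..d}"
      have "(\<Prod>m=1..M. pochhammer (\<gamma> j) (c j m)) \<ge> 0"
        by (intro prod_nonneg) (auto intro!: pochhammer_nonneg \<gamma>)
      then show "g j (u j) * ennreal ((\<Prod>m=1..M. pochhammer (\<gamma> j) (c j m)) * (1 / (1 + u j) powr (real (n j) + real M * \<gamma> j)))
        = ennreal (\<Prod>m=1..M. pochhammer (\<gamma> j) (c j m)) * ennreal (u j ^ (n j - 1) / Gamma (real (n j)) *
        (1 / (1 + u j) powr (real (n j) + real M * \<gamma> j)))"
        using up[OF j] Gamma_real_pos[of "real (n j)"] n[OF j]
        by (simp add: g_def ennreal_mult[symmetric])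
    qed
    also have "\<dots> = ennreal (\<Prod>j=1..d. \<Prod>m=1..M. pochhammer (\<gamma> j) (c j m)) *
        (ennreal (\<Prod>j=1..d. u j ^ (n j - 1) / Gamma (real (n j)) *
        (1 / (1 + u j) powr (real (n j) + real M * \<gamma> j))))"
    proof (subst prod.distrib, intro arg_cong2[where f = "(*)"] prod_ennreal)
      fix j assume j: "j \<in> {1..d}"
      show "0 \<le> u j ^ (n j - 1) / Gamma (real (n j)) * (1 / (1 + u j) powr (real (n j) + real M * \<gamma> j))"
        using up[OF j] Gamma_real_pos[of "real (n j)"] n[OF j] by simp
    qed (auto intro!: prod_nonneg pochhammer_nonneg \<gamma>)
    finally show ?thesis using True by simp
  qed
  have "label_prob d \<gamma> n M f
      = (\<integral>\<^sup>+S. \<integral>\<^sup>+u. (\<Prod>j=1..d. g j (u j) * (\<Prod>m=1..M. h j m (u j) (S (j, m)))) \<partial>(\<Pi>\<^sub>M j\<in>{1..d}. lborel) \<partial>G)"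
    unfolding label_prob_def G_def[symmetric] by (intro nn_integral_cong 1)
  \<comment> \<open>Tonelli makes \<open>S\<close> the inner variable; for fixed \<open>u\<close>
    the integrand is a product over the pairs \<open>(j, m)\<close>, evaluated in
    \<open>2\<close>.\<close>
  also have "\<dots> = (\<integral>\<^sup>+u. \<integral>\<^sup>+S. (\<Prod>j=1..d. g j (u j) * (\<Prod>m=1..M. h j m (u j) (S (j, m)))) \<partial>G \<partial>(\<Pi>\<^sub>M j\<in>{1..d}. lborel))"
    unfolding h_def by (intro PP.Fubini'[symmetric]) measurable
  also have "\<dots> = (\<integral>\<^sup>+u. ennreal (\<Prod>j=1..d. \<Prod>m=1..M. pochhammer (\<gamma> j) (c j m)) *
        (ennreal (\<Prod>j=1..d. u j ^ (n j - 1) / Gamma (real (n j)) *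
        (1 / (1 + u j) powr (real (n j) + real M * \<gamma> j))) * indicator ({1..d} \<rightarrow>\<^sub>E {0<..}) u) \<partial>(\<Pi>\<^sub>M j\<in>{1..d}. lborel))"
    by (intro nn_integral_cong 2)
  also have "\<dots> = ennreal (\<Prod>j=1..d. \<Prod>m=1..M. pochhammer (\<gamma> j) (c j m)) *
    (\<integral>\<^sup>+u\<in>{1..d} \<rightarrow>\<^sub>E {0<..}. ennreal (\<Prod>j=1..d. u j ^ (n j - 1) / Gamma (real (n j)) *
        (1 / (1 + u j) powr (real (n j) + real M * \<gamma> j))) \<partial>(\<Pi>\<^sub>M j\<in>{1..d}. lborel))"
    by (intro nn_integral_cmult meas)
  finally show ?thesis unfolding c_def .
qed

section \<open>The law of the samples\<close>

lemma nn_integral_vec_fdp: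
  assumes "prob_space P0" "\<And>j. j \<in> {1..d} \<Longrightarrow> \<gamma> j > 0"
    and g: "g \<in> borel_measurable (\<Pi>\<^sub>M j\<in>{1..d}. prob_algebra P0)"
  shows "(\<integral>\<^sup>+p. g p \<partial>vec_fdp d \<Lambda> \<gamma> P0) = (\<integral>\<^sup>+k. \<integral>\<^sup>+x.
      g (\<lambda>j\<in>{1..d}. normalized_atoms P0 (Suc k) (\<lambda>m. snd x (j, m)) (fst x))
      \<partial>((\<Pi>\<^sub>M m\<in>{1..Suc k}. P0) \<Otimes>\<^sub>M (\<Pi>\<^sub>M (j, m)\<in>{1..d} \<times> {1..Suc k}. gamma_law (\<gamma> j)))
      \<partial>poisson_pmf \<Lambda>)"
proof -
  note k = measurable_prob_algebraD[OF vec_fdp_kernel[of P0 d \<gamma> "poisson_pmf \<Lambda>", OF assms(1,2), simplified Let_def]]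
  have "(\<integral>\<^sup>+p. g p \<partial>distr ((\<Pi>\<^sub>M m\<in>{1..Suc k}. P0) \<Otimes>\<^sub>M (\<Pi>\<^sub>M (j, m)\<in>{1..d} \<times> {1..Suc k}. gamma_law (\<gamma> j)))
       (\<Pi>\<^sub>M j\<in>{1..d}. prob_algebra P0)
       (\<lambda>(\<tau>, S). \<lambda>j\<in>{1..d}. normalized_atoms P0 (Suc k) (\<lambda>m. S (j, m)) \<tau>))
    = (\<integral>\<^sup>+x. g (\<lambda>j\<in>{1..d}. normalized_atoms P0 (Suc k) (\<lambda>m. snd x (j, m)) (fst x))
      \<partial>((\<Pi>\<^sub>M m\<in>{1..Suc k}. P0) \<Otimes>\<^sub>M (\<Pi>\<^sub>M (j, m)\<in>{1..d} \<times> {1..Suc k}. gamma_law (\<gamma> j))))" for k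
    by (subst nn_integral_distr[OF measurable_vec_fdp_map]) (simp_all add: g[simplified] case_prod_beta')
  then show ?thesis
    unfolding vec_fdp_def Let_def by (subst nn_integral_bind[OF g k]) simp_all
qed

text \<open>Each factor is a sum over atoms. Multiplying out means choosing an atom for every
  observation, that is, a labelling. Each resulting term is a function of the atoms times a function
  of the weights, and the two are independent.\<close>

lemma nn_integral_prod_normalized_atoms:
  assumes P0: "prob_space P0" and \<gamma>: "\<And>j. \<gamma> j > 0" and M: "M > 0"
    and A: "\<And>p. p \<in> sample_index d n \<Longrightarrow> A p \<in> sets P0"
  shows "(\<integral>\<^sup>+x. (\<Prod>(j, i)\<in>sample_index d n.
        emeasure (normalized_atoms P0 M (\<lambda>m. snd x (j, m)) (fst x)) (A (j, i)))
      \<partial>((\<Pi>\<^sub>M m\<in>{1..M}. P0) \<Otimes>\<^sub>M (\<Pi>\<^sub>M (j, m)\<in>{1..d} \<times> {1..M}. gamma_law (\<gamma> j))))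
    = (\<Sum>f\<in>sample_index d n \<rightarrow>\<^sub>E {1..M}. label_prob d \<gamma> n M f *
        emeasure (\<Pi>\<^sub>M m\<in>{1..M}. P0)
          {\<tau> \<in> space (\<Pi>\<^sub>M m\<in>{1..M}. P0). \<forall>p\<in>sample_index d n. \<tau> (f p) \<in> A p})"
proof -
  define I where "I = sample_index d n"
  define G where "G = (\<Pi>\<^sub>M (j, m)\<in>{1..d} \<times> {1..M}. gamma_law (\<gamma> j))"
  define T where "T = (\<Pi>\<^sub>M m\<in>{1..M}. P0)"
  define w where "w f S = (\<Prod>(j, i)\<in>I. ennreal (S (j, f (j, i)) / (\<Sum>r=1..M. S (j, r))))" for f and S :: "nat \<times> nat \<Rightarrow> real"
  define B where "B f = {\<tau> \<in> space T. \<forall>p\<in>I. \<tau> (f p) \<in> A p}" for f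
  have I: "finite I" by (simp add: I_def)
  have ps: "prob_space (case p of (j, m) \<Rightarrow> gamma_law (\<gamma> j))" for p :: "nat \<times> nat"
    by (cases p) (simp add: prob_space_gamma_law \<gamma>)
  interpret G: prob_space G unfolding G_def by (rule prob_space_PiM) (rule ps)
  have Gm[measurable]: "(\<lambda>S. S (j, m)) \<in> borel_measurable G" if "j \<in> {1..d}" "m \<in> {1..M}" for j m
    unfolding G_def using that by (rule measurable_gamma_law_component)
  have wm[measurable]: "w f \<in> borel_measurable G" if "f \<in> I \<rightarrow>\<^sub>E {1..M}" for f
  proof -
    have "(\<lambda>S. ennreal (S (j, f (j, i)) / (\<Sum>r=1..M. S (j, r)))) \<in> borel_measurable G" if "(j, i) \<in> I" for j i
    proof -
      have "j \<in> {1..d}" "f (j, i) \<in> {1..M}" using that \<open>f \<in> _\<close> by (auto simp: I_def PiE_def Pi_def)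
      then show ?thesis by measurable
    qed
    then show ?thesis unfolding w_def case_prod_beta' by (intro borel_measurable_prod_ennreal) auto
  qed
  have Bm[measurable]: "B f \<in> sets T" if "f \<in> I \<rightarrow>\<^sub>E {1..M}" for f
  proof -
    have "{\<tau> \<in> space T. \<tau> (f p) \<in> A p} \<in> sets T" if "p \<in> I" for p
    proof -
      have "(\<lambda>\<tau>. \<tau> (f p)) \<in> T \<rightarrow>\<^sub>M P0"
        unfolding T_def using that \<open>f \<in> _\<close> by (intro measurable_component_singleton) auto
      then show ?thesis using A[of p] that unfolding I_def by measurable
    qed
    then show ?thesis unfolding B_def using I by (intro sets.sets_Collect_finite_All) auto
  qed
  have "(\<Prod>(j, i)\<in>I. emeasure (normalized_atoms P0 M (\<lambda>m. snd x (j, m)) (fst x)) (A (j, i)))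
      = (\<Sum>f\<in>I \<rightarrow>\<^sub>E {1..M}. indicator (B f) (fst x) * w f (snd x))" if x: "x \<in> space (T \<Otimes>\<^sub>M G)" for x
  proof -
    have "(\<Prod>(j, i)\<in>I. emeasure (normalized_atoms P0 M (\<lambda>m. snd x (j, m)) (fst x)) (A (j, i)))
        = (\<Prod>p\<in>I. \<Sum>m=1..M. ennreal (snd x (fst p, m) / (\<Sum>r=1..M. snd x (fst p, r))) * indicator (A p) (fst x m))"
      unfolding case_prod_beta' using A by (intro prod.cong) (auto simp: emeasure_normalized_atoms I_def)
    also have "\<dots> = (\<Sum>f\<in>I \<rightarrow>\<^sub>E {1..M}. \<Prod>p\<in>I. ennreal (snd x (fst p, f p) / (\<Sum>r=1..M. snd x (fst p, r))) * indicator (A p) (fst x (f p)))"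
      using I by (intro prod_sum_PiE) auto
    also have "\<dots> = (\<Sum>f\<in>I \<rightarrow>\<^sub>E {1..M}. indicator (B f) (fst x) * w f (snd x))"
    proof (intro sum.cong refl)
      fix f
      have "(\<Prod>p\<in>I. indicator (A p) (fst x (f p)) :: ennreal) = indicator (B f) (fst x)"
        using x I by (auto simp: B_def indicator_def space_pair_measure intro!: prod.neutral)
      then show "(\<Prod>p\<in>I. ennreal (snd x (fst p, f p) / (\<Sum>r=1..M. snd x (fst p, r))) * indicator (A p) (fst x (f p)))
          = indicator (B f) (fst x) * w f (snd x)"
        by (simp add: prod.distrib w_def case_prod_beta' mult.commute)
    qed
    finally show ?thesis .
  qed
  then have "(\<integral>\<^sup>+x. (\<Prod>(j, i)\<in>I. emeasure (normalized_atoms P0 M (\<lambda>m. snd x (j, m)) (fst x)) (A (j, i))) \<partial>(T \<Otimes>\<^sub>M G))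
      = (\<integral>\<^sup>+x. (\<Sum>f\<in>I \<rightarrow>\<^sub>E {1..M}. indicator (B f) (fst x) * w f (snd x)) \<partial>(T \<Otimes>\<^sub>M G))"
    by (intro nn_integral_cong)
  also have "\<dots> = (\<Sum>f\<in>I \<rightarrow>\<^sub>E {1..M}. \<integral>\<^sup>+x. indicator (B f) (fst x) * w f (snd x) \<partial>(T \<Otimes>\<^sub>M G))"
    by (intro nn_integral_sum) measurable
  also have "\<dots> = (\<Sum>f\<in>I \<rightarrow>\<^sub>E {1..M}. label_prob d \<gamma> n M f * emeasure T (B f))"
  proof (intro sum.cong refl)
    fix f assume f: "f \<in> I \<rightarrow>\<^sub>E {1..M}"
    note [measurable] = wm[OF f] Bm[OF f]
    have "(\<integral>\<^sup>+x. indicator (B f) (fst x) * w f (snd x) \<partial>(T \<Otimes>\<^sub>M G))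
        = (\<integral>\<^sup>+\<tau>. \<integral>\<^sup>+S. indicator (B f) \<tau> * w f S \<partial>G \<partial>T)"
      by (subst G.nn_integral_fst[symmetric]) auto
    also have "\<dots> = (\<integral>\<^sup>+\<tau>. indicator (B f) \<tau> * (\<integral>\<^sup>+S. w f S \<partial>G) \<partial>T)"
      by (intro nn_integral_cong nn_integral_cmult) measurable
    also have "\<dots> = (\<integral>\<^sup>+S. w f S \<partial>G) * emeasure T (B f)"
      by (subst nn_integral_multc) (auto simp: mult.commute)
    also have "(\<integral>\<^sup>+S. w f S \<partial>G) = label_prob d \<gamma> n M f"
      unfolding label_prob_def w_def G_def I_def ..
    finally show "(\<integral>\<^sup>+x. indicator (B f) (fst x) * w f (snd x) \<partial>(T \<Otimes>\<^sub>M G))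
        = label_prob d \<gamma> n M f * emeasure T (B f)" .
  qed
  finally show ?thesis unfolding T_def G_def I_def B_def .
qed

section \<open>From the conditional law to the joint law of the samples\<close>

lemma borel_measurable_prod_emeasure:
  assumes A: "\<And>p. p \<in> sample_index d n \<Longrightarrow> A p \<in> sets N"
  shows "(\<lambda>p. \<Prod>(j, i)\<in>sample_index d n. emeasure (p j) (A (j, i)))
    \<in> borel_measurable (\<Pi>\<^sub>M j\<in>{1..d}. prob_algebra N)"
  unfolding case_prod_beta'
proof (intro borel_measurable_prod_ennreal)
  fix q assume q: "q \<in> sample_index d n"
  then have "(\<lambda>p. p (fst q)) \<in> (\<Pi>\<^sub>M j\<in>{1..d}. prob_algebra N) \<rightarrow>\<^sub>M prob_algebra N"
    by (intro measurable_component_singleton) auto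
  then show "(\<lambda>p. emeasure (p (fst q)) (A (fst q, snd q))) \<in> borel_measurable (\<Pi>\<^sub>M j\<in>{1..d}. prob_algebra N)"
    using A[OF q]
    by (intro measurable_compose[OF measurable_prob_algebraD measurable_emeasure_subprob_algebra]) auto
qed

text \<open>The integral of a conditional probability is the unconditional one. Since this
  conditional probability is a function of the random measures, the integral can be moved to their
  law, which is what the model prescribes.\<close>

lemma emeasure_cond_indep_samples:
  assumes \<Omega>: "prob_space \<Omega>" and ci: "cond_indep_samples \<Omega> N d n P \<theta>"
    and A: "\<And>p. p \<in> sample_index d n \<Longrightarrow> A p \<in> sets N"
  shows "emeasure \<Omega> {\<omega> \<in> space \<Omega>. \<forall>(j, i)\<in>sample_index d n. \<theta> j i \<omega> \<in> A (j, i)}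
    = (\<integral>\<^sup>+p. (\<Prod>(j, i)\<in>sample_index d n. emeasure (p j) (A (j, i)))
        \<partial>distr \<Omega> (\<Pi>\<^sub>M j\<in>{1..d}. prob_algebra N) (\<lambda>\<omega>. \<lambda>j\<in>{1..d}. P j \<omega>))"
proof -
  interpret prob_space \<Omega> by fact
  define B where "B = {\<omega> \<in> space \<Omega>. \<forall>j\<in>{1..d}. \<forall>i\<in>{1..n j}. \<theta> j i \<omega> \<in> A (j, i)}"
  let ?F = "vimage_algebra (space \<Omega>) (\<lambda>\<omega>. \<lambda>j\<in>{1..d}. P j \<omega>) (\<Pi>\<^sub>M j\<in>{1..d}. prob_algebra N)"
  let ?g = "\<lambda>p. \<Prod>(j, i)\<in>sample_index d n. emeasure (p j) (A (j, i))"
  have Pm: "P j \<in> \<Omega> \<rightarrow>\<^sub>M prob_algebra N" if "j \<in> {1..d}" for j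
    using ci that by (auto simp: cond_indep_samples_def)
  have \<theta>m: "\<theta> j i \<in> \<Omega> \<rightarrow>\<^sub>M N" if "j \<in> {1..d}" "i \<in> {1..n j}" for j i
    using ci that by (auto simp: cond_indep_samples_def)
  have Pm': "(\<lambda>\<omega>. \<lambda>j\<in>{1..d}. P j \<omega>) \<in> \<Omega> \<rightarrow>\<^sub>M (\<Pi>\<^sub>M j\<in>{1..d}. prob_algebra N)"
    using Pm by (intro measurable_restrict)
  have B[measurable]: "B \<in> sets \<Omega>"
    unfolding B_def
  proof (intro sets.sets_Collect_finite_All)
    fix j i assume "j \<in> {1..d}" "i \<in> {1..n j}"
    then show "{\<omega> \<in> space \<Omega>. \<theta> j i \<omega> \<in> A (j, i)} \<in> sets \<Omega>"
      using measurable_sets[OF \<theta>m A[of "(j, i)"], of j i] by (simp add: vimage_def Int_def conj_commute)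
  qed auto
  have "subalgebra \<Omega> ?F"
    using sets_image_in_sets[OF refl Pm'] by (simp add: subalgebra_def)
  then interpret finite_measure_subalgebra \<Omega> ?F
    by unfold_locales
  have sz: "(\<integral>\<omega>. real_cond_exp \<Omega> ?F (indicator B) \<omega> \<partial>\<Omega>) = (\<integral>\<omega>. indicator B \<omega> \<partial>\<Omega>)"
    by (rule real_cond_exp_int) (simp add: emeasure_eq_measure)
  have ce: "AE \<omega> in \<Omega>. real_cond_exp \<Omega> ?F (indicator B) \<omega> = (\<Prod>j=1..d. \<Prod>i=1..n j. measure (P j \<omega>) (A (j, i)))"
    using ci A unfolding cond_indep_samples_def B_def by auto
  have mm: "(\<lambda>\<omega>. measure (P j \<omega>) (A (j, i))) \<in> borel_measurable \<Omega>" if "j \<in> {1..d}" "i \<in> {1..n j}" for j i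
    using measurable_compose[OF measurable_prob_algebraD[OF Pm] measurable_measure_subprob_algebra] that A[of "(j, i)"] by auto
  have pP: "prob_space (P j \<omega>)" if "j \<in> {1..d}" "\<omega> \<in> space \<Omega>" for j \<omega>
    using measurable_space[OF Pm[OF that(1)] that(2)] by (simp add: space_prob_algebra)
  \<comment> \<open>The bound 1 makes the product integrable, which allows the Bochner integral to
    be read as a nonnegative one.\<close>
  have bnd: "norm (\<Prod>j=1..d. \<Prod>i=1..n j. measure (P j \<omega>) (A (j, i))) \<le> 1" if "\<omega> \<in> space \<Omega>" for \<omega>
    unfolding real_norm_def abs_prod
    by (intro prod_le_1 conjI prod_nonneg ballI) (use pP that in \<open>auto intro: prob_space.prob_le_1\<close>)
  have "measure \<Omega> B = (\<integral>\<omega>. indicator B \<omega> \<partial>\<Omega>)" by simp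
  also have "\<dots> = (\<integral>\<omega>. (\<Prod>j=1..d. \<Prod>i=1..n j. measure (P j \<omega>) (A (j, i))) \<partial>\<Omega>)"
    unfolding sz[symmetric] using ce mm by (intro integral_cong_AE) (auto intro!: borel_measurable_prod)
  finally have "emeasure \<Omega> B = ennreal (\<integral>\<omega>. (\<Prod>j=1..d. \<Prod>i=1..n j. measure (P j \<omega>) (A (j, i))) \<partial>\<Omega>)"
    by (simp add: emeasure_eq_measure)
  also have "\<dots> = (\<integral>\<^sup>+\<omega>. ennreal (\<Prod>j=1..d. \<Prod>i=1..n j. measure (P j \<omega>) (A (j, i))) \<partial>\<Omega>)"
    using bnd mm
    by (intro nn_integral_eq_integral[symmetric] integrable_const_bound[where B = 1])
       (auto intro!: borel_measurable_prod prod_nonneg)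
  also have "\<dots> = (\<integral>\<^sup>+\<omega>. ?g (\<lambda>j\<in>{1..d}. P j \<omega>) \<partial>\<Omega>)"
  proof (intro nn_integral_cong)
    fix \<omega> assume \<omega>: "\<omega> \<in> space \<Omega>"
    have "ennreal (\<Prod>j=1..d. \<Prod>i=1..n j. measure (P j \<omega>) (A (j, i)))
        = (\<Prod>j=1..d. \<Prod>i=1..n j. ennreal (measure (P j \<omega>) (A (j, i))))"
      by (simp add: prod_ennreal prod_nonneg)
    also have "\<dots> = (\<Prod>j=1..d. \<Prod>i=1..n j. emeasure (P j \<omega>) (A (j, i)))"
      using pP[OF _ \<omega>]
      by (intro prod.cong refl finite_measure.emeasure_eq_measure[symmetric] prob_space.finite_measure)
    also have "\<dots> = ?g (\<lambda>j\<in>{1..d}. P j \<omega>)"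
      by (subst prod.Sigma) (auto intro!: prod.cong)
    finally show "ennreal (\<Prod>j=1..d. \<Prod>i=1..n j. measure (P j \<omega>) (A (j, i))) = ?g (\<lambda>j\<in>{1..d}. P j \<omega>)" .
  qed
  also have "\<dots> = (\<integral>\<^sup>+p. ?g p \<partial>distr \<Omega> (\<Pi>\<^sub>M j\<in>{1..d}. prob_algebra N) (\<lambda>\<omega>. \<lambda>j\<in>{1..d}. P j \<omega>))"
    by (rule nn_integral_distr[OF Pm', symmetric])
       (simp only: measurable_distr_eq1, intro borel_measurable_prod_emeasure A)
  also have "B = {\<omega> \<in> space \<Omega>. \<forall>(j, i)\<in>sample_index d n. \<theta> j i \<omega> \<in> A (j, i)}"
    by (auto simp: B_def)
  finally show ?thesis .
qed

text \<open>For sums over a Poisson value and a labelling: the set of labellings varies with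
  \<open>k\<close>, so the index set is a dependent sum.\<close>

lemma nn_integral_count_space_Sigma_finite:
  fixes h :: "'a \<times> 'b \<Rightarrow> ennreal"
  assumes "\<And>k. finite (F k)"
  shows "(\<integral>\<^sup>+x. h x \<partial>count_space (Sigma UNIV F)) = (\<integral>\<^sup>+k. (\<Sum>f\<in>F k. h (k, f)) \<partial>count_space UNIV)"
proof -
  have "(\<integral>\<^sup>+x. h x \<partial>count_space (Sigma UNIV F))
      = (\<integral>\<^sup>+x. h x * indicator (Sigma UNIV F) x \<partial>count_space UNIV)"
    by (simp add: nn_integral_count_space_indicator)
  also have "\<dots> = (\<integral>\<^sup>+k. \<integral>\<^sup>+f. h (k, f) * indicator (Sigma UNIV F) (k, f) \<partial>count_space UNIV \<partial>count_space UNIV)"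
    by (rule nn_integral_fst_count_space[symmetric])
  also have "\<dots> = (\<integral>\<^sup>+k. \<integral>\<^sup>+f. h (k, f) * indicator (F k) f \<partial>count_space UNIV \<partial>count_space UNIV)"
    by (intro nn_integral_cong) (auto simp: indicator_def)
  also have "\<dots> = (\<integral>\<^sup>+k. (\<Sum>f\<in>F k. h (k, f)) \<partial>count_space UNIV)"
    by (simp add: nn_integral_count_space_indicator[symmetric] nn_integral_count_space_finite assms)
  finally show ?thesis .
qed

text \<open>Conditional independence gives the formula on rectangles only, but the cluster event is
  not a rectangle. The right-hand side is therefore realised as a measure \<open>Q\<close> evaluated
  at \<open>B\<close>; agreement of \<open>Q\<close> with the law of the samples on rectangles,
  which generate the product and are stable under intersection, then extends to all measurable
  sets.\<close>

lemma emeasure_samples: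
  assumes \<Omega>: "prob_space \<Omega>" and P0: "prob_space P0" and \<gamma>: "\<And>j. \<gamma> j > 0"
    and ci: "cond_indep_samples \<Omega> P0 d n P \<theta>"
    and law: "distr \<Omega> (\<Pi>\<^sub>M j\<in>{1..d}. prob_algebra P0) (\<lambda>\<omega>. \<lambda>j\<in>{1..d}. P j \<omega>) = vec_fdp d \<Lambda> \<gamma> P0"
    and B: "B \<in> sets (\<Pi>\<^sub>M p\<in>sample_index d n. P0)"
  shows "emeasure \<Omega> {\<omega> \<in> space \<Omega>. (\<lambda>(j, i)\<in>sample_index d n. \<theta> j i \<omega>) \<in> B}
    = (\<integral>\<^sup>+k. (\<Sum>f\<in>sample_index d n \<rightarrow>\<^sub>E {1..Suc k}. label_prob d \<gamma> n (Suc k) f *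
        emeasure (\<Pi>\<^sub>M m\<in>{1..Suc k}. P0)
          {\<tau> \<in> space (\<Pi>\<^sub>M m\<in>{1..Suc k}. P0). (\<lambda>p\<in>sample_index d n. \<tau> (f p)) \<in> B}) \<partial>poisson_pmf \<Lambda>)"
proof -
  interpret prob_space \<Omega> by fact
  define I where "I = sample_index d n"
  define X where "X \<omega> = (\<lambda>(j, i)\<in>I. \<theta> j i \<omega>)" for \<omega>
  define T where "T k = (\<Pi>\<^sub>M m\<in>{1..Suc k}. P0)" for k
  \<comment> \<open>Weight of the pair: the Poisson value \<open>k\<close> stands for
    \<open>Suc k\<close> atoms, the shift by one in the model.\<close>
  define w where "w = (\<lambda>(k, f). ennreal (pmf (poisson_pmf \<Lambda>) k) * label_prob d \<gamma> n (Suc k) f)"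
  define Sg where "Sg = Sigma UNIV (\<lambda>k. I \<rightarrow>\<^sub>E {1..Suc k})"
  define D where "D = density (count_space Sg) w"
  \<comment> \<open>The law of the samples once the labels are fixed: i.i.d. atoms read off along
    \<open>f\<close>.\<close>
  define ker where "ker = (\<lambda>(k, f). distr (T k) (\<Pi>\<^sub>M p\<in>I. P0) (\<lambda>\<tau>. \<lambda>p\<in>I. \<tau> (f p)))"
  define Q where "Q = D \<bind> ker"
  have I: "finite I" by (simp add: I_def)
  have \<theta>m: "\<theta> j i \<in> \<Omega> \<rightarrow>\<^sub>M P0" if "(j, i) \<in> I" for j i
    using ci that by (auto simp: cond_indep_samples_def I_def)
  have X: "X \<in> \<Omega> \<rightarrow>\<^sub>M (\<Pi>\<^sub>M p\<in>I. P0)"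
    unfolding X_def by (intro measurable_restrict) (auto intro: \<theta>m)
  have Tm: "(\<lambda>\<tau>. \<lambda>p\<in>I. \<tau> (f p)) \<in> T k \<rightarrow>\<^sub>M (\<Pi>\<^sub>M p\<in>I. P0)" if "(k, f) \<in> Sg" for k f
    unfolding T_def using that by (intro measurable_restrict measurable_component_singleton) (auto simp: Sg_def)
  have ps: "prob_space (T k)" for k
    unfolding T_def by (rule prob_space_PiM) (rule P0)
  have ker_prob: "prob_space (ker x)" if "x \<in> Sg" for x
    using that prob_space.prob_space_distr[OF ps Tm] by (cases x) (simp add: ker_def)
  have "ker x \<in> space (subprob_algebra (\<Pi>\<^sub>M p\<in>I. P0))" if "x \<in> Sg" for x
    using prob_space_imp_subprob_space[OF ker_prob[OF that]]
    by (cases x) (simp add: space_subprob_algebra ker_def)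
  \<comment> \<open>The index space is discrete, so measurability of the kernel amounts to its
    values being subprobability measures on the product.\<close>
  then have ker: "ker \<in> D \<rightarrow>\<^sub>M subprob_algebra (\<Pi>\<^sub>M p\<in>I. P0)"
    unfolding D_def measurable_cong_sets[OF sets_density refl] by simp
  \<comment> \<open>The label 1 is available for every number of atoms, which provides the nonempty
    index space that the bind rules ask for.\<close>
  have "(0, \<lambda>p\<in>I. 1) \<in> Sg" by (auto simp: Sg_def)
  then have D0: "space D \<noteq> {}" by (auto simp: D_def)
  have Q: "emeasure Q B = (\<integral>\<^sup>+k. (\<Sum>f\<in>I \<rightarrow>\<^sub>E {1..Suc k}. label_prob d \<gamma> n (Suc k) f *
        emeasure (T k) {\<tau> \<in> space (T k). (\<lambda>p\<in>I. \<tau> (f p)) \<in> B}) \<partial>poisson_pmf \<Lambda>)"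
    if B: "B \<in> sets (\<Pi>\<^sub>M p\<in>I. P0)" for B
  proof -
    have "emeasure Q B = (\<integral>\<^sup>+x. w x * emeasure (ker x) B \<partial>count_space Sg)"
      unfolding Q_def using emeasure_bind[OF D0 ker B] by (simp add: D_def nn_integral_density)
    also have "\<dots> = (\<integral>\<^sup>+k. (\<Sum>f\<in>I \<rightarrow>\<^sub>E {1..Suc k}. w (k, f) * emeasure (ker (k, f)) B) \<partial>count_space UNIV)"
      unfolding Sg_def by (intro nn_integral_count_space_Sigma_finite finite_PiE) (auto simp: I)
    also have "\<dots> = (\<integral>\<^sup>+k. ennreal (pmf (poisson_pmf \<Lambda>) k) * (\<Sum>f\<in>I \<rightarrow>\<^sub>E {1..Suc k}. label_prob d \<gamma> n (Suc k) f *
        emeasure (T k) {\<tau> \<in> space (T k). (\<lambda>p\<in>I. \<tau> (f p)) \<in> B}) \<partial>count_space UNIV)"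
    proof (intro nn_integral_cong)
      fix k
      have "emeasure (ker (k, f)) B = emeasure (T k) {\<tau> \<in> space (T k). (\<lambda>p\<in>I. \<tau> (f p)) \<in> B}"
        if "f \<in> I \<rightarrow>\<^sub>E {1..Suc k}" for f
        using emeasure_distr[OF Tm B, of k f] that
        by (simp add: ker_def Sg_def vimage_def Int_def conj_commute)
      then show "(\<Sum>f\<in>I \<rightarrow>\<^sub>E {1..Suc k}. w (k, f) * emeasure (ker (k, f)) B)
         = ennreal (pmf (poisson_pmf \<Lambda>) k) * (\<Sum>f\<in>I \<rightarrow>\<^sub>E {1..Suc k}. label_prob d \<gamma> n (Suc k) f *
        emeasure (T k) {\<tau> \<in> space (T k). (\<lambda>p\<in>I. \<tau> (f p)) \<in> B})"
        unfolding sum_distrib_left by (intro sum.cong) (auto simp: w_def mult.assoc)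
    qed
    finally show ?thesis by (simp add: nn_integral_measure_pmf)
  qed
  have "distr \<Omega> (\<Pi>\<^sub>M p\<in>I. P0) X = Q"
  proof (rule measure_eqI_PiM_finite[where I = I and M = "\<lambda>_. P0"])
    show "sets Q = sets (\<Pi>\<^sub>M p\<in>I. P0)" unfolding Q_def using ker D0 by (rule sets_bind_measurable)
    show "range (\<lambda>_::nat. \<Pi>\<^sub>E p\<in>I. space P0) \<subseteq> prod_algebra I (\<lambda>_. P0)"
      using I by (auto intro!: prod_algebraI_finite)
    show "(\<Union>_::nat. \<Pi>\<^sub>E p\<in>I. space P0) = space (\<Pi>\<^sub>M p\<in>I. P0)" by (simp add: space_PiM)
    show "emeasure (distr \<Omega> (\<Pi>\<^sub>M p\<in>I. P0) X) (\<Pi>\<^sub>E p\<in>I. space P0) \<noteq> \<infinity>" for i :: nat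
      using finite_measure.emeasure_finite[OF prob_space.finite_measure[OF prob_space_distr[OF X]]] by simp
    fix A assume A: "\<And>p. p \<in> I \<Longrightarrow> A p \<in> sets P0"
    then have R: "Pi\<^sub>E I A \<in> sets (\<Pi>\<^sub>M p\<in>I. P0)"
      using I by (intro sets_PiM_I_finite)
    have "emeasure (distr \<Omega> (\<Pi>\<^sub>M p\<in>I. P0) X) (Pi\<^sub>E I A)
        = emeasure \<Omega> {\<omega> \<in> space \<Omega>. \<forall>(j, i)\<in>I. \<theta> j i \<omega> \<in> A (j, i)}"
      unfolding emeasure_distr[OF X R]
      by (rule arg_cong2[where f = emeasure]) (auto simp: X_def PiE_def Pi_def)
    also have "\<dots> = (\<integral>\<^sup>+p. (\<Prod>(j, i)\<in>I. emeasure (p j) (A (j, i))) \<partial>vec_fdp d \<Lambda> \<gamma> P0)"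
      unfolding law[symmetric] I_def
      by (rule emeasure_cond_indep_samples[OF \<Omega> ci]) (rule A[unfolded I_def])
    also have "\<dots> = (\<integral>\<^sup>+k. \<integral>\<^sup>+x.
        (\<Prod>(j, i)\<in>I. emeasure ((\<lambda>j\<in>{1..d}. normalized_atoms P0 (Suc k) (\<lambda>m. snd x (j, m)) (fst x)) j) (A (j, i)))
        \<partial>((\<Pi>\<^sub>M m\<in>{1..Suc k}. P0) \<Otimes>\<^sub>M (\<Pi>\<^sub>M (j, m)\<in>{1..d} \<times> {1..Suc k}. gamma_law (\<gamma> j))) \<partial>poisson_pmf \<Lambda>)"
      using A unfolding I_def by (intro nn_integral_vec_fdp P0 \<gamma> borel_measurable_prod_emeasure)
    also have "\<dots> = (\<integral>\<^sup>+k. \<integral>\<^sup>+x.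
        (\<Prod>(j, i)\<in>I. emeasure (normalized_atoms P0 (Suc k) (\<lambda>m. snd x (j, m)) (fst x)) (A (j, i)))
        \<partial>((\<Pi>\<^sub>M m\<in>{1..Suc k}. P0) \<Otimes>\<^sub>M (\<Pi>\<^sub>M (j, m)\<in>{1..d} \<times> {1..Suc k}. gamma_law (\<gamma> j))) \<partial>poisson_pmf \<Lambda>)"
      by (intro nn_integral_cong prod.cong) (auto simp: I_def)
    also have "\<dots> = (\<integral>\<^sup>+k. (\<Sum>f\<in>I \<rightarrow>\<^sub>E {1..Suc k}. label_prob d \<gamma> n (Suc k) f *
        emeasure (T k) {\<tau> \<in> space (T k). \<forall>p\<in>I. \<tau> (f p) \<in> A p}) \<partial>poisson_pmf \<Lambda>)"
      unfolding I_def T_def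
      by (intro nn_integral_cong nn_integral_prod_normalized_atoms P0 \<gamma> A[unfolded I_def]) auto
    also have "\<dots> = emeasure Q (Pi\<^sub>E I A)"
      unfolding Q[OF R] by (simp add: PiE_iff)
    finally show "emeasure (distr \<Omega> (\<Pi>\<^sub>M p\<in>I. P0) X) (Pi\<^sub>E I A) = emeasure Q (Pi\<^sub>E I A)" .
  qed (use I in auto)
  then have "emeasure Q B = emeasure \<Omega> (X -` B \<inter> space \<Omega>)"
    using emeasure_distr[OF X] B by (simp add: I_def)
  also have "X -` B \<inter> space \<Omega> = {\<omega> \<in> space \<Omega>. (\<lambda>(j, i)\<in>I. \<theta> j i \<omega>) \<in> B}"
    by (auto simp: X_def)
  finally show ?thesis using Q B unfolding I_def T_def by simp
qed

section \<open>Distinct atoms and the number of clusters\<close>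

text \<open>For two indices \<open>a\<close> and \<open>b\<close>, integrate over the coordinate
  \<open>b\<close> with the others held fixed: the event \<open>\<tau> a = \<tau> b\<close> then
  confines it to one point, which is null for a diffuse law. There are finitely many pairs.\<close>

lemma AE_PiM_inj_on:
  fixes P0 :: "'a :: {second_countable_topology, metric_space} measure"
  assumes P0: "prob_space P0" "sets P0 = sets (restrict_space borel \<Theta>)" "diffuse P0" and J: "finite J"
  shows "AE \<tau> in (\<Pi>\<^sub>M m\<in>J. P0). inj_on \<tau> J"
proof -
  interpret product_sigma_finite "\<lambda>_. P0"
    by (rule product_sigma_finite.intro) (rule prob_space_imp_sigma_finite[OF P0(1)])
  have id: "(\<lambda>x. x) \<in> borel_measurable P0"
    by (subst measurable_cong_sets[OF P0(2) refl]) (intro measurable_restrict_space1, simp)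
  have comp: "(\<lambda>\<tau>. \<tau> a) \<in> borel_measurable (\<Pi>\<^sub>M m\<in>J'. P0)" if "a \<in> J'" for a and J' :: "'b set"
    using measurable_compose[OF measurable_component_singleton[OF that] id] .
  have "AE \<tau> in (\<Pi>\<^sub>M m\<in>J. P0). \<tau> a \<noteq> \<tau> b" if ab: "a \<in> J" "b \<in> J" "a \<noteq> b" for a b
  proof -
    let ?J = "J - {b}"
    have Jb: "insert b ?J = J" using ab by auto
    define E where "E = {\<tau> \<in> space (\<Pi>\<^sub>M m\<in>J. P0). \<tau> a = \<tau> b}"
    note [measurable] = comp[OF ab(1)] comp[OF ab(2)]
    \<comment> \<open>Equality is rewritten as vanishing distance, because the distance of two
      measurable maps into a second countable metric space is measurable.\<close>
    have "E = {\<tau> \<in> space (\<Pi>\<^sub>M m\<in>J. P0). dist (\<tau> a) (\<tau> b) = 0}" by (simp add: E_def)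
    also have "\<dots> \<in> sets (\<Pi>\<^sub>M m\<in>J. P0)" by measurable
    finally have E[measurable]: "E \<in> sets (\<Pi>\<^sub>M m\<in>J. P0)" .
    have "emeasure (\<Pi>\<^sub>M m\<in>J. P0) E = (\<integral>\<^sup>+\<tau>. indicator E \<tau> \<partial>(\<Pi>\<^sub>M m\<in>J. P0))" by simp
    also have "\<dots> = (\<integral>\<^sup>+\<tau>. (\<integral>\<^sup>+y. indicator E (\<tau>(b := y)) \<partial>P0) \<partial>(\<Pi>\<^sub>M m\<in>?J. P0))"
      using product_nn_integral_insert[of ?J b "indicator E"] J unfolding Jb by simp
    also have "\<dots> = (\<integral>\<^sup>+\<tau>. 0 \<partial>(\<Pi>\<^sub>M m\<in>?J. P0))"
    proof (intro nn_integral_cong)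
      fix \<tau> assume "\<tau> \<in> space (\<Pi>\<^sub>M m\<in>?J. P0)"
      then have x: "\<tau> a \<in> space P0" using ab by (auto simp: space_PiM)
      have "(\<integral>\<^sup>+y. indicator E (\<tau>(b := y)) \<partial>P0) \<le> (\<integral>\<^sup>+y. indicator {\<tau> a} y \<partial>P0)"
        using ab by (intro nn_integral_mono) (auto simp: E_def indicator_def)
      also have "\<dots> = emeasure P0 {\<tau> a}"
      proof (rule nn_integral_indicator)
        have "{y \<in> space P0. y = \<tau> a} = {y \<in> space P0. dist y (\<tau> a) = 0}" by simp
        also have "\<dots> \<in> sets P0" using id by measurable
        also have "{y \<in> space P0. y = \<tau> a} = {\<tau> a}" using x by auto
        finally show "{\<tau> a} \<in> sets P0" .
      qed
      also have "\<dots> = 0" using P0(3) x by (simp add: diffuse_def)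
      finally show "(\<integral>\<^sup>+y. indicator E (\<tau>(b := y)) \<partial>P0) = 0" by simp
    qed
    finally have "E \<in> null_sets (\<Pi>\<^sub>M m\<in>J. P0)" using E by auto
    then show ?thesis by (rule AE_I') (auto simp: E_def)
  qed
  then have "AE \<tau> in (\<Pi>\<^sub>M m\<in>J. P0). \<forall>a\<in>J. \<forall>b\<in>J. a \<noteq> b \<longrightarrow> \<tau> a \<noteq> \<tau> b"
    using J by (intro AE_finite_allI) auto
  then show ?thesis by (rule AE_mp) (auto simp: inj_on_def)
qed

text \<open>Having \<open>K\<close> values means having a set \<open>J\<close> of \<open>K\<close>
  indices that represents each value exactly once. This is a finite Boolean combination of the
  events \<open>x a = x b\<close>.\<close>

lemma sets_card_image_eq:
  fixes P0 :: "'a :: {second_countable_topology, metric_space} measure"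
  assumes P0: "sets P0 = sets (restrict_space borel \<Theta>)" and I: "finite I"
  shows "{x \<in> space (\<Pi>\<^sub>M p\<in>I. P0). card (x ` I) = K} \<in> sets (\<Pi>\<^sub>M p\<in>I. P0)"
proof -
  have id: "(\<lambda>x. x) \<in> borel_measurable P0"
    by (subst measurable_cong_sets[OF P0 refl]) (intro measurable_restrict_space1, simp)
  have eq: "{x \<in> space (\<Pi>\<^sub>M p\<in>I. P0). x a = x b} \<in> sets (\<Pi>\<^sub>M p\<in>I. P0)" if "a \<in> I" "b \<in> I" for a b
  proof -
    note [measurable] = measurable_compose[OF measurable_component_singleton[OF that(1)] id]
      measurable_compose[OF measurable_component_singleton[OF that(2)] id]
    have "{x \<in> space (\<Pi>\<^sub>M p\<in>I. P0). dist (x a) (x b) = 0} \<in> sets (\<Pi>\<^sub>M p\<in>I. P0)"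
      by measurable
    then show ?thesis by simp
  qed
  have "card (x ` I) = K \<longleftrightarrow> (\<exists>J\<in>{J\<in>Pow I. card J = K}. (\<forall>a\<in>J. \<forall>b\<in>J. x a = x b \<longrightarrow> a = b) \<and> (\<forall>a\<in>I. \<exists>b\<in>J. x a = x b))"
    (is "_ \<longleftrightarrow> (\<exists>J\<in>_. ?Q J)") for x :: "'b \<Rightarrow> 'a"
  proof
    assume K: "card (x ` I) = K"
    \<comment> \<open>\<open>J\<close> picks one index from every fibre of \<open>x\<close> on
      \<open>I\<close>.\<close>
    obtain J where J: "J \<subseteq> I" "inj_on x J" "x ` J = x ` I"
      using subset_image_inj[of "x ` I" x I] by auto
    then have "card J = K" using K card_image by metis
    moreover have "?Q J" using J by (force simp: inj_on_def)
    ultimately show "\<exists>J\<in>{J\<in>Pow I. card J = K}. ?Q J" using J by blast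
  next
    assume "\<exists>J\<in>{J\<in>Pow I. card J = K}. ?Q J"
    then obtain J where J: "J \<subseteq> I" "card J = K" "?Q J" by auto
    then have "inj_on x J" "x ` I = x ` J" by (auto simp: inj_on_def)
    then show "card (x ` I) = K" using J by (simp add: card_image)
  qed
  then have "{x \<in> space (\<Pi>\<^sub>M p\<in>I. P0). card (x ` I) = K}
      = {x \<in> space (\<Pi>\<^sub>M p\<in>I. P0). \<exists>J\<in>{J\<in>Pow I. card J = K}.
          (\<forall>a\<in>J. \<forall>b\<in>J. x a = x b \<longrightarrow> a = b) \<and> (\<forall>a\<in>I. \<exists>b\<in>J. x a = x b)}"
    by simp
  also have "\<dots> \<in> sets (\<Pi>\<^sub>M p\<in>I. P0)"
  proof (intro sets.sets_Collect_finite_Ex sets.sets_Collect_conj sets.sets_Collect_finite_All sets.sets_Collect_imp)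
  qed (use I in \<open>auto intro: eq finite_subset\<close>)
  finally show ?thesis .
qed

lemma emeasure_num_clusters:
  fixes P0 :: "'a :: {second_countable_topology, metric_space} measure"
  assumes \<Omega>: "prob_space \<Omega>"
    and P0: "prob_space P0" "sets P0 = sets (restrict_space borel \<Theta>)" "diffuse P0"
    and \<gamma>: "\<And>j. \<gamma> j > 0"
    and ci: "cond_indep_samples \<Omega> P0 d n P \<theta>"
    and law: "distr \<Omega> (\<Pi>\<^sub>M j\<in>{1..d}. prob_algebra P0) (\<lambda>\<omega>. \<lambda>j\<in>{1..d}. P j \<omega>) = vec_fdp d \<Lambda> \<gamma> P0"
  shows "emeasure \<Omega> {\<omega> \<in> space \<Omega>. num_clusters d n \<theta> \<omega> = K}
    = (\<integral>\<^sup>+k. (\<Sum>f\<in>{f \<in> sample_index d n \<rightarrow>\<^sub>E {1..Suc k}. card (f ` sample_index d n) = K}.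
        label_prob d \<gamma> n (Suc k) f) \<partial>poisson_pmf \<Lambda>)"
proof -
  define I where "I = sample_index d n"
  define B where "B = {x \<in> space (\<Pi>\<^sub>M p\<in>I. P0). card (x ` I) = K}"
  have I: "finite I" by (simp add: I_def)
  have Bs: "B \<in> sets (\<Pi>\<^sub>M p\<in>I. P0)" unfolding B_def using P0(2) I by (rule sets_card_image_eq)
  have \<theta>m: "\<theta> j i \<in> \<Omega> \<rightarrow>\<^sub>M P0" if "(j, i) \<in> I" for j i
    using ci that by (auto simp: cond_indep_samples_def I_def)
  have nc: "num_clusters d n \<theta> \<omega> = card ((\<lambda>(j, i)\<in>I. \<theta> j i \<omega>) ` I)" for \<omega>
  proof -
    have "{\<theta> j i \<omega> | j i. j \<in> {1..d} \<and> i \<in> {1..n j}} = (\<lambda>(j, i)\<in>I. \<theta> j i \<omega>) ` I"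
      by (force simp: I_def image_iff)
    then show ?thesis by (simp add: num_clusters_def)
  qed
  have "{\<omega> \<in> space \<Omega>. num_clusters d n \<theta> \<omega> = K} = {\<omega> \<in> space \<Omega>. (\<lambda>(j, i)\<in>I. \<theta> j i \<omega>) \<in> B}"
    using measurable_space[OF \<theta>m] by (auto simp: nc B_def space_PiM)
  also have "emeasure \<Omega> \<dots> = (\<integral>\<^sup>+k. (\<Sum>f\<in>I \<rightarrow>\<^sub>E {1..Suc k}. label_prob d \<gamma> n (Suc k) f *
        emeasure (\<Pi>\<^sub>M m\<in>{1..Suc k}. P0)
          {\<tau> \<in> space (\<Pi>\<^sub>M m\<in>{1..Suc k}. P0). (\<lambda>p\<in>I. \<tau> (f p)) \<in> B}) \<partial>poisson_pmf \<Lambda>)"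
    unfolding I_def by (rule emeasure_samples[OF \<Omega> P0(1) \<gamma> ci law Bs[unfolded I_def]])
  also have "\<dots> = (\<integral>\<^sup>+k. (\<Sum>f\<in>{f \<in> I \<rightarrow>\<^sub>E {1..Suc k}. card (f ` I) = K}.
        label_prob d \<gamma> n (Suc k) f) \<partial>poisson_pmf \<Lambda>)"
  proof (intro nn_integral_cong)
    fix k
    let ?T = "\<Pi>\<^sub>M m\<in>{1..Suc k}. P0"
    interpret T: prob_space ?T by (rule prob_space_PiM) (rule P0(1))
    \<comment> \<open>Outside the null set where atoms coincide, the event depends on the labelling
      alone. Its probability is 0 or 1, and it acts as a filter on the labellings.\<close>
    have "emeasure ?T {\<tau> \<in> space ?T. (\<lambda>p\<in>I. \<tau> (f p)) \<in> B} = (if card (f ` I) = K then 1 else 0)"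
      if f: "f \<in> I \<rightarrow>\<^sub>E {1..Suc k}" for f
    proof -
      have fm: "(\<lambda>\<tau>. \<lambda>p\<in>I. \<tau> (f p)) \<in> ?T \<rightarrow>\<^sub>M (\<Pi>\<^sub>M p\<in>I. P0)"
        using f by (intro measurable_restrict measurable_component_singleton) auto
      have "AE \<tau> in ?T. inj_on \<tau> {1..Suc k}"
        using P0 by (rule AE_PiM_inj_on) simp
      then have "AE \<tau> in ?T. \<tau> \<in> {\<tau> \<in> space ?T. (\<lambda>p\<in>I. \<tau> (f p)) \<in> B}
          \<longleftrightarrow> \<tau> \<in> (if card (f ` I) = K then space ?T else {})"
      proof (rule AE_mp, intro AE_I2 impI)
        fix \<tau> assume \<tau>: "\<tau> \<in> space ?T" "inj_on \<tau> {1..Suc k}"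
        have "(\<lambda>p\<in>I. \<tau> (f p)) ` I = \<tau> ` f ` I" by auto
        moreover have "card (\<tau> ` f ` I) = card (f ` I)"
          using f by (intro card_image inj_on_subset[OF \<tau>(2)]) auto
        ultimately show "\<tau> \<in> {\<tau> \<in> space ?T. (\<lambda>p\<in>I. \<tau> (f p)) \<in> B}
          \<longleftrightarrow> \<tau> \<in> (if card (f ` I) = K then space ?T else {})"
          using \<tau>(1) measurable_space[OF fm \<tau>(1)] by (simp add: B_def)
      qed
      then have "emeasure ?T {\<tau> \<in> space ?T. (\<lambda>p\<in>I. \<tau> (f p)) \<in> B}
          = emeasure ?T (if card (f ` I) = K then space ?T else {})"
        by (rule emeasure_eq_AE) (use measurable_sets[OF fm Bs] in \<open>auto simp: vimage_def Int_def conj_commute\<close>)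
      then show ?thesis by (simp add: T.emeasure_space_1[simplified])
    qed
    then have "(\<Sum>f\<in>I \<rightarrow>\<^sub>E {1..Suc k}. label_prob d \<gamma> n (Suc k) f *
          emeasure ?T {\<tau> \<in> space ?T. (\<lambda>p\<in>I. \<tau> (f p)) \<in> B})
        = (\<Sum>f\<in>I \<rightarrow>\<^sub>E {1..Suc k}. if card (f ` I) = K then label_prob d \<gamma> n (Suc k) f else 0)"
      by (intro sum.cong) auto
    also have "\<dots> = (\<Sum>f\<in>{f \<in> I \<rightarrow>\<^sub>E {1..Suc k}. card (f ` I) = K}. label_prob d \<gamma> n (Suc k) f)"
      using I by (intro sum.inter_filter[symmetric] finite_PiE) auto
    finally show "(\<Sum>f\<in>I \<rightarrow>\<^sub>E {1..Suc k}. label_prob d \<gamma> n (Suc k) f *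
          emeasure ?T {\<tau> \<in> space ?T. (\<lambda>p\<in>I. \<tau> (f p)) \<in> B})
      = (\<Sum>f\<in>{f \<in> I \<rightarrow>\<^sub>E {1..Suc k}. card (f ` I) = K}. label_prob d \<gamma> n (Suc k) f)" .
  qed
  finally show ?thesis unfolding I_def .
qed

section \<open>The Poisson mixture\<close>

text \<open>Let \<open>l\<close> be the number of atoms that are not observed, so
  \<open>k = l + (K - 1)\<close>. The factorials collapse to \<open>(l + K) / fact l\<close>; with
  \<open>x = \<Lambda> * y\<close> the part with \<open>K\<close> sums to \<open>K * exp x\<close>
  and the part with \<open>l\<close> to \<open>x * exp x\<close>. This is the origin of the factor
  \<open>K + \<Lambda> * y\<close>.\<close>

lemma poisson_binomial_sums:
  fixes \<Lambda> y :: real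
  assumes K: "K \<ge> 1"
  shows "(\<lambda>k. \<Lambda> ^ k / fact k * exp (- \<Lambda>) * (real (Suc k choose K) * fact K) * y ^ Suc k) sums
    (\<Lambda> ^ (K - 1) * (real K + \<Lambda> * y) * exp (- \<Lambda> * (1 - y)) * y ^ K)"
    (is "?f sums ?s")
proof -
  let ?x = "\<Lambda> * y"
  let ?c = "\<Lambda> ^ (K - 1) * exp (- \<Lambda>) * y ^ K"
  have e: "(\<lambda>l. ?x ^ l / fact l) sums exp ?x"
    using exp_converges[of ?x] by (simp add: scaleR_conv_of_real divide_inverse mult.commute)
  have "(\<lambda>l. ?x * (?x ^ l / fact l)) sums (?x * exp ?x)"
    by (intro sums_mult e)
  moreover have "?x * (?x ^ l / fact l) = real (Suc l) * (?x ^ Suc l / fact (Suc l))" for l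
    by (simp add: divide_simps)
  ultimately have "(\<lambda>l. real (Suc l) * (?x ^ Suc l / fact (Suc l))) sums (?x * exp ?x)"
    by (simp only:)
  \<comment> \<open>The term put in front by the index shift is zero at
    \<open>l = 0\<close>.\<close>
  then have "(\<lambda>l. real l * (?x ^ l / fact l)) sums (?x * exp ?x + real 0 * (?x ^ 0 / fact 0))"
    by (rule iffD1[OF sums_Suc_iff[of "\<lambda>l. real l * (?x ^ l / fact l)"]])
  then have e': "(\<lambda>l. real l * (?x ^ l / fact l)) sums (?x * exp ?x)"
    by simp
  have "(\<lambda>l. ?c * (real K * (?x ^ l / fact l) + real l * (?x ^ l / fact l))) sums
      (?c * (real K * exp ?x + ?x * exp ?x))"
    by (intro sums_mult sums_add e e')
  moreover have "?c * (real K * (?x ^ l / fact l) + real l * (?x ^ l / fact l)) = ?f (l + (K - 1))" for l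
  proof -
    have Suc: "Suc (l + (K - 1)) = l + K" using K by simp
    have "real (l + K choose K) * fact K = fact (l + K) / fact l"
      by (simp add: binomial_fact)
    also have "fact (l + K) = real (l + K) * fact (l + (K - 1))"
      using K by (simp add: fact_reduce)
    finally have b: "real (l + K choose K) * fact K / fact (l + (K - 1)) = real (l + K) / fact l"
      by (simp add: field_simps)
    have "?f (l + (K - 1)) = \<Lambda> ^ (l + (K - 1)) * exp (- \<Lambda>) * y ^ (l + K)
        * (real (l + K choose K) * fact K / fact (l + (K - 1)))"
      unfolding Suc by simp
    also have "\<dots> = ?c * (real K * (?x ^ l / fact l) + real l * (?x ^ l / fact l))"
      unfolding b by (simp add: power_add power_mult_distrib field_simps)
    finally show ?thesis by simp
  qed
  ultimately have "(\<lambda>l. ?f (l + (K - 1))) sums (?c * (real K * exp ?x + ?x * exp ?x))"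
    by simp
  \<comment> \<open>With fewer than \<open>K\<close> atoms there cannot be \<open>K\<close>
    clusters: the binomial coefficient is zero.\<close>
  moreover have "(\<Sum>k<K - 1. ?f k) = 0"
    by (intro sum.neutral) (auto simp: binomial_eq_0)
  ultimately have "?f sums (?c * (real K * exp ?x + ?x * exp ?x))"
    by (subst (asm) sums_iff_shift) simp
  also have "?c * (real K * exp ?x + ?x * exp ?x)
      = \<Lambda> ^ (K - 1) * (real K + ?x) * (exp (- \<Lambda>) * exp ?x) * y ^ K"
    by (simp add: algebra_simps)
  also have "exp (- \<Lambda>) * exp ?x = exp (- \<Lambda> * (1 - y))"
    by (simp add: exp_add[symmetric] algebra_simps)
  finally show ?thesis .
qed

text \<open>The number of atoms enters the integrand only as a power of \<open>psi\<close>, so for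
  each \<open>u\<close> the Poisson series is summed by \<open>poisson_binomial_sums\<close> at
  \<open>y = psi d \<gamma> u\<close>. The constant \<open>R\<close> is a placeholder for the double
  sum over \<open>r1\<close> and \<open>r2\<close>.\<close>

lemma poisson_mixture_V_coeff:
  assumes \<Lambda>: "\<Lambda> > 0" and \<gamma>: "\<And>j. \<gamma> j > 0" and n: "\<And>j. j \<in> {1..d} \<Longrightarrow> n j \<ge> 1" and K: "K \<ge> 1"
    and R: "R \<ge> 0"
  shows "enn2real (\<integral>\<^sup>+k. ennreal (real (Suc k choose K) * fact K * R) *
      (\<integral>\<^sup>+u\<in>{1..d} \<rightarrow>\<^sub>E {0<..}. ennreal (\<Prod>j=1..d. u j ^ (n j - 1) / Gamma (real (n j)) *
        (1 / (1 + u j) powr (real (n j) + real (Suc k) * \<gamma> j))) \<partial>(\<Pi>\<^sub>M j\<in>{1..d}. lborel)) \<partial>poisson_pmf \<Lambda>)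
    = V_coeff d n K \<gamma> \<Lambda> * R"
proof -
  define L where "L = (\<Pi>\<^sub>M j\<in>{1..d}. (lborel :: real measure))"
  define E where "E = ({1..d} \<rightarrow>\<^sub>E {0<..} :: (nat \<Rightarrow> real) set)"
  \<comment> \<open>The variable \<open>x\<close> stands for the number of atoms; \<open>h 0\<close>
    is the part of the integrand that is free of it.\<close>
  define h where "h x u = (\<Prod>j=1..d. u j ^ (n j - 1) / Gamma (real (n j)) *
        (1 / (1 + u j) powr (real (n j) + x * \<gamma> j)))" for x :: real and u
  have E[measurable]: "E \<in> sets L" unfolding E_def L_def by (intro sets_PiM_I_finite) auto
  have hm[measurable]: "h x \<in> borel_measurable L" for x unfolding h_def L_def by measurable
  have psim[measurable]: "psi d \<gamma> \<in> borel_measurable L" unfolding psi_def L_def by measurable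
  have Psim[measurable]: "Psi d \<gamma> \<Lambda> K \<in> borel_measurable L" unfolding Psi_def by measurable
  have up: "u j > 0" if "u \<in> E" "j \<in> {1..d}" for u j using that by (auto simp: E_def)
  have psi0: "psi d \<gamma> u > 0" if "u \<in> E" for u
    unfolding psi_def
  proof (intro prod_pos ballI)
    fix j assume "j \<in> {1..d}"
    then have "1 + u j > 0" using up[OF that] by (simp add: add_pos_pos)
    then show "1 / (1 + u j) powr \<gamma> j > 0" by simp
  qed
  have h0: "h x u \<ge> 0" if "u \<in> E" for x u
    unfolding h_def
  proof (intro prod_nonneg ballI)
    fix j assume j: "j \<in> {1..d}"
    show "0 \<le> u j ^ (n j - 1) / Gamma (real (n j)) * (1 / (1 + u j) powr (real (n j) + x * \<gamma> j))"
      using up[OF that j] Gamma_real_pos[of "real (n j)"] n[OF j] by simp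
  qed
  have h_add: "h (real m) u = h 0 u * psi d \<gamma> u ^ m" if "u \<in> E" for m u
  proof -
    have "psi d \<gamma> u ^ m = (\<Prod>j=1..d. 1 / (1 + u j) powr (real m * \<gamma> j))"
      unfolding psi_def prod_power_distrib
    proof (intro prod.cong refl)
      fix j assume "j \<in> {1..d}"
      then have "1 + u j > 0" using up[OF that] by (simp add: add_pos_pos)
      then show "(1 / (1 + u j) powr \<gamma> j) ^ m = 1 / (1 + u j) powr (real m * \<gamma> j)"
        by (simp add: power_divide powr_power mult.commute)
    qed
    then show ?thesis
      unfolding h_def by (simp add: prod.distrib[symmetric] powr_add mult.assoc)
  qed
  have Psi0: "Psi d \<gamma> \<Lambda> K u \<ge> 0" if "u \<in> E" for u
    unfolding Psi_def using \<Lambda> less_imp_le[OF psi0[OF that]] by (intro mult_nonneg_nonneg add_nonneg_nonneg) auto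
  have series: "(\<Sum>k. ennreal (pmf (poisson_pmf \<Lambda>) k * (real (Suc k choose K) * fact K * R) * h (real (Suc k)) u))
      = ennreal R * ennreal (Psi d \<gamma> \<Lambda> K u * h (real K) u)" if u: "u \<in> E" for u
  proof -
    let ?y = "psi d \<gamma> u"
    have "(\<lambda>k. R * h 0 u * (\<Lambda> ^ k / fact k * exp (- \<Lambda>) * (real (Suc k choose K) * fact K) * ?y ^ Suc k)) sums
        (R * h 0 u * (\<Lambda> ^ (K - 1) * (real K + \<Lambda> * ?y) * exp (- \<Lambda> * (1 - ?y)) * ?y ^ K))"
      by (intro sums_mult poisson_binomial_sums K)
    also have "(\<lambda>k. R * h 0 u * (\<Lambda> ^ k / fact k * exp (- \<Lambda>) * (real (Suc k choose K) * fact K) * ?y ^ Suc k))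
        = (\<lambda>k. pmf (poisson_pmf \<Lambda>) k * (real (Suc k choose K) * fact K * R) * h (real (Suc k)) u)"
      using \<Lambda> by (intro ext) (simp add: h_add[OF u] del: power_Suc binomial_Suc_Suc of_nat_Suc)
    \<comment> \<open>The power \<open>?y ^ K\<close> left by the series turns \<open>h 0\<close>
      into \<open>h K\<close>, which supplies the term \<open>K * \<gamma> j\<close> in the
      exponents of \<open>V_coeff\<close>.\<close>
    also have "R * h 0 u * (\<Lambda> ^ (K - 1) * (real K + \<Lambda> * ?y) * exp (- \<Lambda> * (1 - ?y)) * ?y ^ K)
        = R * (Psi d \<gamma> \<Lambda> K u * h (real K) u)"
      unfolding Psi_def h_add[OF u] by (simp only: mult_ac)
    finally have "(\<Sum>k. ennreal (pmf (poisson_pmf \<Lambda>) k * (real (Suc k choose K) * fact K * R) * h (real (Suc k)) u))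
        = ennreal (R * (Psi d \<gamma> \<Lambda> K u * h (real K) u))"
      using R h0[OF u] by (intro suminf_ennreal_eq) (auto intro!: mult_nonneg_nonneg)
    then show ?thesis using R Psi0[OF u] h0[OF u] by (simp add: ennreal_mult)
  qed
  have "(\<integral>\<^sup>+k. ennreal (real (Suc k choose K) * fact K * R) * (\<integral>\<^sup>+u\<in>E. ennreal (h (real (Suc k)) u) \<partial>L) \<partial>poisson_pmf \<Lambda>)
      = (\<Sum>k. ennreal (pmf (poisson_pmf \<Lambda>) k) * (ennreal (real (Suc k choose K) * fact K * R) * (\<integral>\<^sup>+u\<in>E. ennreal (h (real (Suc k)) u) \<partial>L)))"
    by (simp only: nn_integral_measure_pmf nn_integral_count_space_nat)
  also have "\<dots> = (\<Sum>k. \<integral>\<^sup>+u\<in>E. ennreal (pmf (poisson_pmf \<Lambda>) k * (real (Suc k choose K) * fact K * R) * h (real (Suc k)) u) \<partial>L)"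
  proof (intro suminf_cong)
    fix k
    let ?c = "pmf (poisson_pmf \<Lambda>) k * (real (Suc k choose K) * fact K * R)"
    have "ennreal (pmf (poisson_pmf \<Lambda>) k) * (ennreal (real (Suc k choose K) * fact K * R) * (\<integral>\<^sup>+u\<in>E. ennreal (h (real (Suc k)) u) \<partial>L))
        = ennreal ?c * (\<integral>\<^sup>+u\<in>E. ennreal (h (real (Suc k)) u) \<partial>L)"
      using R by (simp only: mult.assoc[symmetric] ennreal_mult pmf_nonneg of_nat_0_le_iff fact_ge_zero mult_nonneg_nonneg)
    also have "\<dots> = (\<integral>\<^sup>+u. ennreal ?c * (ennreal (h (real (Suc k)) u) * indicator E u) \<partial>L)"
      by (intro nn_integral_cmult[symmetric]) measurable
    also have "\<dots> = (\<integral>\<^sup>+u\<in>E. ennreal (?c * h (real (Suc k)) u) \<partial>L)"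
    proof (intro nn_integral_cong)
      fix u
      have "?c \<ge> 0" using R by (intro mult_nonneg_nonneg) auto
      then have "ennreal (?c * h (real (Suc k)) u) = ennreal ?c * ennreal (h (real (Suc k)) u)"
        by (rule ennreal_mult')
      then show "ennreal ?c * (ennreal (h (real (Suc k)) u) * indicator E u) = ennreal (?c * h (real (Suc k)) u) * indicator E u"
        by (simp only: mult.assoc[of "ennreal ?c"])
    qed
    finally show "ennreal (pmf (poisson_pmf \<Lambda>) k) * (ennreal (real (Suc k choose K) * fact K * R) * (\<integral>\<^sup>+u\<in>E. ennreal (h (real (Suc k)) u) \<partial>L))
      = (\<integral>\<^sup>+u\<in>E. ennreal (?c * h (real (Suc k)) u) \<partial>L)" .
  qed
  also have "\<dots> = (\<integral>\<^sup>+u. (\<Sum>k. ennreal (pmf (poisson_pmf \<Lambda>) k * (real (Suc k choose K) * fact K * R) * h (real (Suc k)) u) * indicator E u) \<partial>L)"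
    by (intro nn_integral_suminf[symmetric]) measurable
  also have "\<dots> = (\<integral>\<^sup>+u. ennreal R * (ennreal (Psi d \<gamma> \<Lambda> K u * h (real K) u) * indicator E u) \<partial>L)"
    by (intro nn_integral_cong) (auto simp: indicator_def series simp del: binomial_Suc_Suc of_nat_Suc)
  also have "\<dots> = ennreal R * (\<integral>\<^sup>+u. ennreal (Psi d \<gamma> \<Lambda> K u * h (real K) u) * indicator E u \<partial>L)"
    by (intro nn_integral_cmult) measurable
  also have "(\<integral>\<^sup>+u. ennreal (Psi d \<gamma> \<Lambda> K u * h (real K) u) * indicator E u \<partial>L)
      = (\<integral>\<^sup>+u. ennreal (indicator E u *\<^sub>R (Psi d \<gamma> \<Lambda> K u * h (real K) u)) \<partial>L)"
    by (intro nn_integral_cong) (auto simp: indicator_def)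
  finally have eq: "(\<integral>\<^sup>+k. ennreal (real (Suc k choose K) * fact K * R) * (\<integral>\<^sup>+u\<in>E. ennreal (h (real (Suc k)) u) \<partial>L) \<partial>poisson_pmf \<Lambda>)
      = ennreal R * (\<integral>\<^sup>+u. ennreal (indicator E u *\<^sub>R (Psi d \<gamma> \<Lambda> K u * h (real K) u)) \<partial>L)" .
  have "V_coeff d n K \<gamma> \<Lambda> = (\<integral>u. indicator E u *\<^sub>R (Psi d \<gamma> \<Lambda> K u * h (real K) u) \<partial>L)"
    unfolding V_coeff_def set_lebesgue_integral_def h_def E_def L_def ..
  \<comment> \<open>For a nonnegative measurable function this identity covers an infinite integral
    as well, both sides then being 0, so no integrability has to be established.\<close>
  also have "\<dots> = enn2real (\<integral>\<^sup>+u. ennreal (indicator E u *\<^sub>R (Psi d \<gamma> \<Lambda> K u * h (real K) u)) \<partial>L)"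
    using Psi0 h0 by (intro integral_eq_nn_integral) (auto intro!: AE_I2 simp: indicator_def)
  finally have V: "V_coeff d n K \<gamma> \<Lambda> = \<dots>" .
  show ?thesis
    unfolding V E_def[symmetric] L_def[symmetric] h_def[symmetric] eq
    using R by (simp add: enn2real_mult mult.commute)
qed

section \<open>Assembly of the formula\<close>

lemma vec_fdp_cong:
  assumes "\<And>j. j \<in> {1..d} \<Longrightarrow> \<gamma> j = \<gamma>' j"
  shows "vec_fdp d \<Lambda> \<gamma> P0 = vec_fdp d \<Lambda> \<gamma>' P0"
proof -
  have "(\<Pi>\<^sub>M (j, m)\<in>{1..d} \<times> {1..M}. gamma_law (\<gamma> j)) = (\<Pi>\<^sub>M (j, m)\<in>{1..d} \<times> {1..M}. gamma_law (\<gamma>' j))" for M :: nat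
    using assms by (intro PiM_cong) auto
  then show ?thesis unfolding vec_fdp_def by simp
qed

lemma V_coeff_cong:
  assumes "\<And>j. j \<in> {1..d} \<Longrightarrow> \<gamma> j = \<gamma>' j"
  shows "V_coeff d n K \<gamma> \<Lambda> = V_coeff d n K \<gamma>' \<Lambda>"
proof -
  have "psi d \<gamma> u = psi d \<gamma>' u" for u
    unfolding psi_def by (intro prod.cong) (simp_all add: assms)
  moreover have "(\<Prod>j=1..d. u j ^ (n j - 1) / Gamma (real (n j)) * (1 / (1 + u j) powr (real (n j) + real K * \<gamma> j)))
      = (\<Prod>j=1..d. u j ^ (n j - 1) / Gamma (real (n j)) * (1 / (1 + u j) powr (real (n j) + real K * \<gamma>' j)))"
    for u :: "nat \<Rightarrow> real"
    by (intro prod.cong) (simp_all add: assms)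
  ultimately show ?thesis unfolding V_coeff_def Psi_def by (simp only:)
qed

lemma measure_num_clusters:
  fixes P0 :: "'a :: {second_countable_topology, metric_space} measure"
  assumes \<Omega>: "prob_space \<Omega>"
    and P0: "prob_space P0" "sets P0 = sets (restrict_space borel \<Theta>)" "diffuse P0"
    and \<Lambda>: "\<Lambda> > 0" and \<gamma>: "\<And>j. \<gamma> j > 0" and n: "\<And>j. j \<in> {1..2} \<Longrightarrow> n j \<ge> 1"
    and ci: "cond_indep_samples \<Omega> P0 2 n P \<theta>"
    and law: "distr \<Omega> (\<Pi>\<^sub>M j\<in>{1..2}. prob_algebra P0) (\<lambda>\<omega>. \<lambda>j\<in>{1..2}. P j \<omega>) = vec_fdp 2 \<Lambda> \<gamma> P0"
    and K: "K \<ge> 1"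
  shows "measure \<Omega> {\<omega> \<in> space \<Omega>. num_clusters 2 n \<theta> \<omega> = K} =
    V_coeff 2 n K \<gamma> \<Lambda> *
    (\<Sum>r1=0..K. \<Sum>r2=0..K - r1.
       real ((K - r1) choose r2) * (fact (K - r2) / fact r1) *
       (\<bar>gen_fact_coeff (n 1) (K - r1) (- \<gamma> 1)\<bar> * \<bar>gen_fact_coeff (n 2) (K - r2) (- \<gamma> 2)\<bar>))"
    (is "_ = _ * ?R")
proof -
  let ?I = "sample_index 2 n"
  let ?F = "\<lambda>k. {f \<in> ?I \<rightarrow>\<^sub>E {1..Suc k}. card (f ` ?I) = K}"
  let ?w = "\<lambda>k f. \<Prod>j=1..2. \<Prod>m=1..Suc k. pochhammer (\<gamma> j) (card {i\<in>{1..n j}. f (j, i) = m})"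
  let ?J = "\<lambda>k. \<integral>\<^sup>+u\<in>{1..2} \<rightarrow>\<^sub>E {0<..}. ennreal (\<Prod>j=1..2. u j ^ (n j - 1) / Gamma (real (n j)) *
        (1 / (1 + u j) powr (real (n j) + real (Suc k) * \<gamma> j))) \<partial>(\<Pi>\<^sub>M j\<in>{1..2}. lborel)"
  have "emeasure \<Omega> {\<omega> \<in> space \<Omega>. num_clusters 2 n \<theta> \<omega> = K}
      = (\<integral>\<^sup>+k. (\<Sum>f\<in>?F k. label_prob 2 \<gamma> n (Suc k) f) \<partial>poisson_pmf \<Lambda>)"
    by (rule emeasure_num_clusters[OF \<Omega> P0 \<gamma> ci law])
  also have "\<dots> = (\<integral>\<^sup>+k. ennreal (real (Suc k choose K) * fact K * ?R) * ?J k \<partial>poisson_pmf \<Lambda>)"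
  proof (intro nn_integral_cong)
    fix k
    \<comment> \<open>All labellings into \<open>Suc k\<close> labels share the same
      \<open>u\<close>-integral, which therefore factors out and leaves the counting sum.\<close>
    have "(\<Sum>f\<in>?F k. label_prob 2 \<gamma> n (Suc k) f) = (\<Sum>f\<in>?F k. ennreal (?w k f) * ?J k)"
      by (intro sum.cong refl label_prob_eq \<gamma> n) auto
    also have "\<dots> = ennreal (\<Sum>f\<in>?F k. ?w k f) * ?J k"
      unfolding sum_distrib_right[symmetric]
      by (intro arg_cong2[where f = "(*)"] refl sum_ennreal prod_nonneg ballI pochhammer_nonneg \<gamma>)
    also have "(\<Sum>f\<in>?F k. ?w k f) = real (Suc k choose K) * fact K * ?R"
      using sum_two_groups_prod_pochhammer[of "{1..Suc k}" \<gamma> n K] \<gamma> by simp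
    finally show "(\<Sum>f\<in>?F k. label_prob 2 \<gamma> n (Suc k) f) = ennreal (real (Suc k choose K) * fact K * ?R) * ?J k" .
  qed
  finally have "measure \<Omega> {\<omega> \<in> space \<Omega>. num_clusters 2 n \<theta> \<omega> = K}
      = enn2real (\<integral>\<^sup>+k. ennreal (real (Suc k choose K) * fact K * ?R) * ?J k \<partial>poisson_pmf \<Lambda>)"
    by (simp only: measure_def)
  also have "\<dots> = V_coeff 2 n K \<gamma> \<Lambda> * ?R"
    by (intro poisson_mixture_V_coeff \<Lambda> \<gamma> n K sum_nonneg mult_nonneg_nonneg) auto
  finally show ?thesis .
qed

theorem theorem4:
  fixes \<Omega> :: "'w measure"
    and \<Theta> :: "(real ^ 's) set"
    and P0 :: "(real ^ 's) measure"
    and \<Lambda> :: real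
    and \<gamma> :: "nat \<Rightarrow> real"
    and n :: "nat \<Rightarrow> nat"
    and P :: "nat \<Rightarrow> 'w \<Rightarrow> (real ^ 's) measure"
    and \<theta> :: "nat \<Rightarrow> nat \<Rightarrow> 'w \<Rightarrow> real ^ 's"
    and K :: nat
  assumes "prob_space \<Omega>"
    and "prob_space P0"
    and "sets P0 = sets (restrict_space borel \<Theta>)"
    and "diffuse P0"
    and "\<Lambda> > 0"
    and "\<gamma> 1 > 0" and "\<gamma> 2 > 0"
    and "n 1 \<ge> 1" and "n 2 \<ge> 1"
    and "cond_indep_samples \<Omega> P0 2 n P \<theta>"
    and "distr \<Omega> (\<Pi>\<^sub>M j\<in>{1..2}. prob_algebra P0) (\<lambda>\<omega>. \<lambda>j\<in>{1..2}. P j \<omega>) = vec_fdp 2 \<Lambda> \<gamma> P0"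
    and "K \<in> {1..n 1 + n 2}"
  shows "measure \<Omega> {\<omega> \<in> space \<Omega>. num_clusters 2 n \<theta> \<omega> = K} =
    V_coeff 2 n K \<gamma> \<Lambda> *
    (\<Sum>r1=0..K. \<Sum>r2=0..K - r1.
       real ((K - r1) choose r2) * (fact (K - r2) / fact r1) *
       (\<bar>gen_fact_coeff (n 1) (K - r1) (- \<gamma> 1)\<bar> * \<bar>gen_fact_coeff (n 2) (K - r2) (- \<gamma> 2)\<bar>))"
proof -
  \<comment> \<open>Product measures are developed for families that are \<open>\<sigma>\<close>-finite at every index, so \<open>\<gamma>\<close> must be positive off \<open>{1, 2}\<close> too.\<close>
  define \<gamma>' where "\<gamma>' j = (if j \<in> {1..2} then \<gamma> j else 1)" for j
  have two: "j = 1 \<or> j = 2" if "j \<in> {1..2}" for j :: nat using that by auto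
  have pos: "\<gamma>' j > 0" for j using assms(6,7) two[of j] by (auto simp: \<gamma>'_def)
  have n: "n j \<ge> 1" if "j \<in> {1..2}" for j using two[OF that] assms(8,9) by auto
  have K: "K \<ge> 1" using assms(12) by simp
  have law: "distr \<Omega> (\<Pi>\<^sub>M j\<in>{1..2}. prob_algebra P0) (\<lambda>\<omega>. \<lambda>j\<in>{1..2}. P j \<omega>) = vec_fdp 2 \<Lambda> \<gamma>' P0"
    unfolding assms(11) by (rule vec_fdp_cong) (simp add: \<gamma>'_def)
  have V: "V_coeff 2 n K \<gamma>' \<Lambda> = V_coeff 2 n K \<gamma> \<Lambda>"
    by (rule V_coeff_cong) (simp add: \<gamma>'_def)
  have \<gamma>: "\<gamma>' 1 = \<gamma> 1" "\<gamma>' 2 = \<gamma> 2" by (auto simp: \<gamma>'_def)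
  show ?thesis
    using measure_num_clusters[OF assms(1-5) pos n assms(10) law K] unfolding V \<gamma> .
qed

end
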